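(* Let $\lambda,\mu$ be partitions with at most $n$ parts, and let $T$ be the highest or lowest weight vector of $\mathscr{B}(\mu)$. Then $\Phi_T:\mathscr{B}(\lambda)\to\mathscr{B}(\lambda+\mu)$, $\Phi_T(T')=T'\star T$, is a crystal embedding. In particular, the images are the induced subgraphs $$\Phi_{A_\mu}(\mathscr{B}(\lambda))=\mathsf{E}(Z_\lambda\star A_\mu)\qquad\text{and}\qquad\Phi_{Z_\mu}(\mathscr{B}(\lambda))=\mathsf{F}(A_\lambda\star Z_\mu),$$ and yield isomorphic embeddings of $\mathscr{B}(\lambda)$ into $\mathscr{B}(\lambda+\mu)$.
   Context: For a partition $\lambda$ with at most $n$ parts, $\mathrm{SSYT}_n(\lambda)$ is the set of semistandard Young tableaux of shape $\lambda$ (English notation; strictly increasing down columns, weakly increasing along rows) with entries in $\{1,\dots,n\}$. For $T$ of shape $\lambda$ and $T'$ of shape $\mu$, $T\star T'$ is the semistandard Young tableau of shape $\lambda+\mu$ obtained by horizontally concatenating the rows and sorting the entries in each row in weakly increasing order. The $\mathfrak{sl}_n$-crystal $\mathscr{B}(\lambda)$ of the irreducible module $V(\lambda)$ is identified with $\mathrm{SSYT}_n(\lambda)$ with the standard crystal operators $e_i,f_i:\mathscr{B}(\lambda)\to\mathscr{B}(\lambda)\cup\{0\}$, $1\le i<n$: in the column reading word of $T$ (entries read up the columns, starting with the leftmost column and moving right), regard each $i+1$ as "(" and each $i$ as ")", and cancel matched pairs; $f_i$ changes the rightmost unmatched $i$ to $i+1$ (and is $0$ if there is none), and $e_i$ changes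 the leftmost unmatched $i+1$ to $i$ (and is $0$ if there is none). The crystal graph has vertex set $\mathscr{B}(\lambda)$ and edges given by the crystal operators. $\mathsf{E}$ and $\mathsf{F}$ are the free monoids generated by $\{e_i\}_{i=1}^{n-1}$ and $\{f_i\}_{i=1}^{n-1}$, acting by composition of operators; $\mathsf{E}(b)$, $\mathsf{F}(b)$ denote the sets of nonzero elements obtained by applying them to $b$ (viewed as induced subgraphs). The highest (resp. lowest) weight vector of $\mathscr{B}(\lambda)$ is the unique $b$ with $\mathsf{E}(b)=\{b\}$ (resp. $\mathsf{F}(b)=\{b\}$), denoted $A_\lambda$ (resp. $Z_\lambda$): $A_\lambda$ has all entries in row $i$ equal to $i$, and in $Z_\lambda$ the $j$-th column, of height $h_j$, has entries $\{n-h_j+1,\dots,n\}$. A map $\Phi:\mathscr{B}\to\mathscr{C}$ between two $\mathfrak{g}$-crystals is an embedding when it is injective, $e_i(x)\ne0$ implies $\Phi(e_i(x))=e_i(\Phi(x))\ne0$, and $f_i(x)\neq0$ implies $\Phi(f_i(x))=f_i(\Phi(x))\ne0$. *)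

theory Defs
  imports "Graph_Theory.Graph_Theory"
begin

section \<open>Crystals\<close>

text \<open>The element 0 that is adjoined to a crystal is rendered as \<open>None\<close>.\<close>

record 'b crystal =
  elts :: "'b set"
  colours :: "nat set"
  raising :: "nat \<Rightarrow> 'b \<Rightarrow> 'b option"
  lowering :: "nat \<Rightarrow> 'b \<Rightarrow> 'b option"

definition crystal_embedding ::
    "'b crystal \<Rightarrow> 'c crystal \<Rightarrow> ('b \<Rightarrow> 'c) \<Rightarrow> bool" where
  "crystal_embedding B C \<Phi> \<longleftrightarrow>
     colours B = colours C \<and> \<Phi> \<in> elts B \<rightarrow> elts C \<and> inj_on \<Phi> (elts B) \<and>
     (\<forall>x\<in>elts B. \<forall>i\<in>colours B. raising B i x \<noteq> None \<longrightarrow>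
        map_option \<Phi> (raising B i x) = raising C i (\<Phi> x) \<and> raising C i (\<Phi> x) \<noteq> None) \<and>
     (\<forall>x\<in>elts B. \<forall>i\<in>colours B. lowering B i x \<noteq> None \<longrightarrow>
        map_option \<Phi> (lowering B i x) = lowering C i (\<Phi> x) \<and> lowering C i (\<Phi> x) \<noteq> None)"

text \<open>A word \<open>[i\<^sub>1, \<dots>, i\<^sub>k]\<close> of the free monoid acts as the composition
  \<open>op i\<^sub>1 \<circ> \<dots> \<circ> op i\<^sub>k\<close>, so its last letter is applied first.\<close>

definition word_act :: "(nat \<Rightarrow> 'b \<Rightarrow> 'b option) \<Rightarrow> nat list \<Rightarrow> 'b \<Rightarrow> 'b option" where
  "word_act op ws b = foldr (\<lambda>i x. Option.bind x (op i)) ws (Some b)"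

definition E_set :: "'b crystal \<Rightarrow> 'b \<Rightarrow> 'b set" where
  "E_set B b = {b'. \<exists>ws\<in>lists (colours B). word_act (raising B) ws b = Some b'}"

definition F_set :: "'b crystal \<Rightarrow> 'b \<Rightarrow> 'b set" where
  "F_set B b = {b'. \<exists>ws\<in>lists (colours B). word_act (lowering B) ws b = Some b'}"

definition highest_weight_vector :: "'b crystal \<Rightarrow> 'b" where
  "highest_weight_vector B = (THE b. b \<in> elts B \<and> E_set B b = {b})"

definition lowest_weight_vector :: "'b crystal \<Rightarrow> 'b" where
  "lowest_weight_vector B = (THE b. b \<in> elts B \<and> F_set B b = {b})"

text \<open>An arc \<open>(x, i, y)\<close> is an edge from \<open>x\<close> to \<open>y\<close> of colour \<open>i\<close>, meaning
  \<open>y = f\<^sub>i x\<close>.\<close>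

definition crystal_graph :: "'b crystal \<Rightarrow> ('b, 'b \<times> nat \<times> 'b) pre_digraph" where
  "crystal_graph B =
     \<lparr>verts = elts B,
      arcs = {(x, i, y). x \<in> elts B \<and> i \<in> colours B \<and> y \<in> elts B \<and> lowering B i x = Some y},
      tail = (\<lambda>(x, i, y). x), head = (\<lambda>(x, i, y). y)\<rparr>"

text \<open>The action of a vertex map on coloured arcs leaves the colour unchanged, so an
  isomorphism of this form is an isomorphism of edge-coloured digraphs.\<close>

definition coloured_hom ::
    "('b \<Rightarrow> 'c) \<Rightarrow> ('b, 'b \<times> nat \<times> 'b, 'c, 'c \<times> nat \<times> 'c) digraph_isomorphism" where
  "coloured_hom \<phi> =
     \<lparr>iso_verts = \<phi>, iso_arcs = (\<lambda>(x, i, y). (\<phi> x, i, \<phi> y)),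
      iso_head = (\<lambda>(x, i, y). y), iso_tail = (\<lambda>(x, i, y). x)\<rparr>"

definition coloured_graph_iso ::
    "('b \<Rightarrow> 'c) \<Rightarrow> ('b, 'b \<times> nat \<times> 'b) pre_digraph \<Rightarrow> ('c, 'c \<times> nat \<times> 'c) pre_digraph \<Rightarrow> bool"
where
  "coloured_graph_iso \<phi> G H \<longleftrightarrow>
     pre_digraph.digraph_isomorphism G (coloured_hom \<phi>) \<and> app_iso (coloured_hom \<phi>) G = H"


section \<open>Semistandard tableaux\<close>

text \<open>Rows and columns are numbered from 0: \<open>lam r\<close> is the part usually written
  \<open>\<lambda>\<^sub>r\<^sub>+\<^sub>1\<close>, and \<open>T r ! c\<close> is the entry of a tableau in row \<open>r\<close>, column \<open>c\<close>.
  Entries are still numbered from 1.\<close>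

definition partition_le :: "nat \<Rightarrow> (nat \<Rightarrow> nat) \<Rightarrow> bool" where
  "partition_le n lam \<longleftrightarrow> antimono lam \<and> (\<forall>r\<ge>n. lam r = 0)"

type_synonym tableau = "nat \<Rightarrow> nat list"
type_synonym cell = "nat \<times> nat"

definition SSYT :: "nat \<Rightarrow> (nat \<Rightarrow> nat) \<Rightarrow> tableau set" where
  "SSYT n lam = {T.
     (\<forall>r. length (T r) = lam r \<and> set (T r) \<subseteq> {1..n} \<and> sorted (T r)) \<and>
     (\<forall>r c. c < lam (Suc r) \<longrightarrow> T r ! c < T (Suc r) ! c)}"

definition star :: "tableau \<Rightarrow> tableau \<Rightarrow> tableau" (infixl \<open>\<star>\<close> 70) where
  "T \<star> T' = (\<lambda>r. sort (T r @ T' r))"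

definition entry :: "tableau \<Rightarrow> cell \<Rightarrow> nat" where
  "entry T = (\<lambda>(r, c). T r ! c)"

definition set_entry :: "tableau \<Rightarrow> cell \<Rightarrow> nat \<Rightarrow> tableau" where
  "set_entry T = (\<lambda>(r, c) a. T(r := (T r)[c := a]))"

text \<open>The cells of a tableau with at most \<open>n\<close> rows, in the order of the column reading word.\<close>

definition reading_cells :: "nat \<Rightarrow> tableau \<Rightarrow> cell list" where
  "reading_cells n T = [(r, c). c \<leftarrow> [0..<length (T 0)], r \<leftarrow> rev [0..<n], c < length (T r)]"

text \<open>The bracket scan keeps the letters not cancelled so far, most recent first; letters other
  than \<open>i\<close> and \<open>i + 1\<close> are dropped. A closing bracket \<open>i\<close> cancels against the most recent
  remaining letter if this is an opening bracket \<open>i + 1\<close>.\<close>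

fun bracket_step :: "nat \<Rightarrow> tableau \<Rightarrow> cell \<Rightarrow> cell list \<Rightarrow> cell list" where
  "bracket_step i T p st =
     (if entry T p = Suc i then p # st
      else if entry T p = i then
        (case st of
           [] \<Rightarrow> [p]
         | q # st' \<Rightarrow> if entry T q = Suc i then st' else p # st)
      else st)"

definition unmatched_cells :: "nat \<Rightarrow> nat \<Rightarrow> tableau \<Rightarrow> cell list" where
  "unmatched_cells n i T = rev (fold (bracket_step i T) (reading_cells n T) [])"

definition f_op :: "nat \<Rightarrow> nat \<Rightarrow> tableau \<Rightarrow> tableau option" where
  "f_op n i T =
     (let ps = filter (\<lambda>p. entry T p = i) (unmatched_cells n i T)
      in if ps = [] then None else Some (set_entry T (last ps) (Suc i)))"

definition e_op :: "nat \<Rightarrow> nat \<Rightarrow> tableau \<Rightarrow> tableau option" where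
  "e_op n i T =
     (let ps = filter (\<lambda>p. entry T p = Suc i) (unmatched_cells n i T)
      in if ps = [] then None else Some (set_entry T (hd ps) i))"

definition tableau_crystal :: "nat \<Rightarrow> (nat \<Rightarrow> nat) \<Rightarrow> tableau crystal" where
  "tableau_crystal n lam =
     \<lparr>elts = SSYT n lam, colours = {1..<n}, raising = e_op n, lowering = f_op n\<rparr>"

end

theory Submission
  imports Defs "HOL-Library.Multiset"
begin

text \<open>
  Fix a colour \<open>i\<close>, and let \<open>a\<^sub>r\<close> and \<open>b\<^sub>r\<close> be the numbers of entries \<open>i\<close> and \<open>i + 1\<close> in row \<open>r\<close>. The
  crystal operators do not change if a tableau is read by rows, from the bottom row to the top row
  and each row from left to right, instead of by columns. In the row reading, row \<open>r\<close> contributes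
  \<open>a\<^sub>r\<close> closing brackets followed by \<open>b\<^sub>r\<close> opening brackets, so that the bracket rule depends only on
  the contents of the rows. It can be stated with the row excess
  \<open>g r = (b\<^sub>0 + \<dots> + b\<^sub>r) - (a\<^sub>0 + \<dots> + a\<^sub>r\<^sub>-\<^sub>1)\<close>, which counts the opening minus the closing brackets
  from the block of opening brackets of row \<open>r\<close> to the end of the word: \<open>f\<^sub>i\<close> changes an entry \<open>i\<close>
  of the last row where \<open>g\<close> is maximal, and gives 0 if there is no such last row because \<open>g\<close> is
  still maximal far below the tableau; \<open>e\<^sub>i\<close> changes an entry \<open>i + 1\<close> of the first row where \<open>g\<close> is
  maximal, and gives 0 if the maximum is not positive. These are the lemmas \<open>f_op_Some\<close>,
  \<open>f_op_None\<close>, \<open>e_op_Some\<close> and \<open>e_op_None\<close>.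

  The product \<open>\<star>\<close> adds the contents of rows, hence also the row excesses. The excess of the lowest
  weight vector is a nonnegative constant, so adding it moves no maximum, and \<open>T' \<mapsto> T' \<star> Z\<^sub>\<mu>\<close>
  commutes with every \<open>f\<^sub>i\<close>, including where the result is 0. It only commutes with \<open>e\<^sub>i\<close> where
  \<open>e\<^sub>i\<close> is nonzero, as the maximum may become positive. The excess of the highest weight vector is
  0 in the rows before row \<open>i\<close> (counted from 0) and a nonpositive constant from row \<open>i\<close> on. There the
  excess of every tableau is constant too, and at most its value in row \<open>i - 1\<close>. So the first
  maximum stays where it is, and so does the last one if it lies before row \<open>i\<close>, that is, if
  \<open>f\<^sub>i\<close> is nonzero. Hence \<open>T' \<mapsto> T' \<star> A\<^sub>\<mu>\<close> commutes with every \<open>e\<^sub>i\<close>, and with \<open>f\<^sub>i\<close> where \<open>f\<^sub>i\<close> is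
  nonzero.

  Every tableau of shape \<open>\<lambda>\<close> is reached from \<open>Z\<^sub>\<lambda>\<close> by raising operators and from \<open>A\<^sub>\<lambda>\<close> by
  lowering operators. A map that commutes with all raising (lowering) operators therefore has the
  orbit of the image of \<open>Z\<^sub>\<lambda>\<close> (of \<open>A\<^sub>\<lambda>\<close>) as its image. Since \<open>e\<^sub>i\<close> and \<open>f\<^sub>i\<close> are partial inverses of
  each other, exactness for one of them also shows that the induced subgraph on the image has no
  arcs other than the images of arcs.
\<close>

section \<open>Rows of semistandard tableaux\<close>

definition num_le :: "tableau \<Rightarrow> nat \<Rightarrow> nat \<Rightarrow> nat" where
  "num_le T v r = length (filter (\<lambda>x. x \<le> v) (T r))"

abbreviation num_eq :: "tableau \<Rightarrow> nat \<Rightarrow> nat \<Rightarrow> nat" where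
  "num_eq T v r \<equiv> count (mset (T r)) v"

lemma sorted_nth_le_iff:
  fixes xs :: "'a::linorder list"
  assumes "sorted xs"
  shows "k < length (filter (\<lambda>x. x \<le> v) xs) \<longleftrightarrow> k < length xs \<and> xs ! k \<le> v"
  using assms
proof (induction xs arbitrary: k)
  case (Cons x xs)
  show ?case
  proof (cases "x \<le> v")
    case True
    then show ?thesis using Cons by (cases k) auto
  next
    case False
    moreover have "filter (\<lambda>x. x \<le> v) xs = []"
      using Cons.prems False by (auto simp: filter_empty_conv)
    moreover have "v < (x # xs) ! k" if "k < length (x # xs)"
      using Cons.prems False that nth_mem[OF that] by auto
    ultimately show ?thesis by fastforce
  qed
qed simp

lemma num_le_Suc: "num_le T (Suc v) r = num_le T v r + num_eq T (Suc v) r"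
proof -
  have "length (filter (\<lambda>x. x \<le> Suc v) xs)
      = length (filter (\<lambda>x. x \<le> v) xs) + count (mset xs) (Suc v)" for xs
    by (induction xs) auto
  then show ?thesis by (simp add: num_le_def)
qed

lemma num_eq_diff:
  assumes "1 \<le> i"
  shows "int (num_eq T i r) = int (num_le T i r) - int (num_le T (i - 1) r)"
    and "int (num_eq T (Suc i) r) = int (num_le T (Suc i) r) - int (num_le T i r)"
  using num_le_Suc[of T "i - 1" r] num_le_Suc[of T i r] assms by auto

lemma num_le_mono: "v \<le> w \<Longrightarrow> num_le T v r \<le> num_le T w r"
  by (induction w rule: dec_induct) (auto simp: num_le_Suc)

lemma num_le_mset: "num_le T v r = size (filter_mset (\<lambda>x. x \<le> v) (mset (T r)))"
  unfolding num_le_def by (metis mset_filter size_mset)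

lemma sorted_eq_if_mset_eq:
  "sorted xs \<Longrightarrow> sorted ys \<Longrightarrow> mset xs = mset ys \<Longrightarrow> xs = ys"
  by (metis properties_for_sort)

lemma SSYT_rowD:
  assumes "T \<in> SSYT n lam"
  shows "length (T r) = lam r" "set (T r) \<subseteq> {1..n}" "sorted (T r)"
  using assms by (auto simp: SSYT_def)

lemma nth_le_iff:
  assumes "T \<in> SSYT n lam"
  shows "c < num_le T v r \<longleftrightarrow> c < lam r \<and> T r ! c \<le> v"
  using sorted_nth_le_iff[OF SSYT_rowD(3)[OF assms]] SSYT_rowD(1)[OF assms]
  by (simp add: num_le_def)

lemma nth_eq_iff:
  assumes "T \<in> SSYT n lam" "1 \<le> v"
  shows "c < lam r \<and> T r ! c = v \<longleftrightarrow> num_le T (v - 1) r \<le> c \<and> c < num_le T v r"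
  using nth_le_iff[OF assms(1), of c "v - 1" r] nth_le_iff[OF assms(1), of c v r] assms(2)
  by auto

text \<open>The entries at most \<open>v\<close> of a sorted row fill an initial segment of its cells. So the columns
  increase strictly exactly when the entries at most \<open>v + 1\<close> of a row lie below entries at most
  \<open>v\<close>, which is the interlacing condition of Gelfand--Tsetlin patterns. In this form the
  condition is about the contents of the rows only.\<close>

lemma SSYT_iff_interlacing:
  assumes "partition_le n lam"
  shows "T \<in> SSYT n lam \<longleftrightarrow>
    (\<forall>r. length (T r) = lam r \<and> set (T r) \<subseteq> {1..n} \<and> sorted (T r)) \<and>
    (\<forall>v r. num_le T (Suc v) (Suc r) \<le> num_le T v r)"
    (is "_ \<longleftrightarrow> ?rows \<and> ?interlacing")
proof -
  have le: "lam (Suc r) \<le> lam r" for r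
    using assms by (auto simp: partition_le_def antimono_def)
  have "(\<forall>r c. c < lam (Suc r) \<longrightarrow> T r ! c < T (Suc r) ! c) \<longleftrightarrow> ?interlacing" if rows: ?rows
  proof -
    have iff: "c < num_le T v r \<longleftrightarrow> c < lam r \<and> T r ! c \<le> v" for c v r
      using rows sorted_nth_le_iff[of "T r" c v] by (auto simp: num_le_def)
    show ?thesis
    proof (intro iffI allI impI)
      fix v r
      assume cols: "\<forall>r c. c < lam (Suc r) \<longrightarrow> T r ! c < T (Suc r) ! c"
      show "num_le T (Suc v) (Suc r) \<le> num_le T v r"
      proof (rule ccontr)
        let ?c = "num_le T v r"
        assume "\<not> ?thesis"
        then have "?c < num_le T (Suc v) (Suc r)" by simp
        then have c: "?c < lam (Suc r)" "T (Suc r) ! ?c \<le> Suc v" by (auto simp: iff)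
        then have "?c < lam r \<and> T r ! ?c \<le> v" using le[of r] cols by fastforce
        then show False using iff[of ?c v r] by simp
      qed
    next
      fix r c
      assume il: ?interlacing and c: "c < lam (Suc r)"
      have "T (Suc r) ! c \<in> {1..n}"
        using rows c by (metis nth_mem subsetD)
      then have "T (Suc r) ! c = Suc (T (Suc r) ! c - 1)" by simp
      moreover have "c < num_le T (T (Suc r) ! c) (Suc r)" using c iff by simp
      ultimately have "c < num_le T (T (Suc r) ! c - 1) r"
        using il by (metis order_less_le_trans)
      then show "T r ! c < T (Suc r) ! c"
        using iff \<open>T (Suc r) ! c = _\<close> by fastforce
    qed
  qed
  then show ?thesis unfolding SSYT_def by blast
qed

lemma num_le_interlaced:
  assumes "partition_le n lam" "T \<in> SSYT n lam"
  shows "num_le T (Suc v) (Suc r) \<le> num_le T v r"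
  using assms(2) unfolding SSYT_iff_interlacing[OF assms(1)] by blast

lemma num_le_antimono:
  assumes "partition_le n lam" "T \<in> SSYT n lam" "r \<le> s"
  shows "num_le T v s \<le> num_le T v r"
  using assms(3)
proof (induction s rule: dec_induct)
  case (step s)
  have "num_le T v (Suc s) \<le> num_le T (Suc v) (Suc s)" by (rule num_le_mono) simp
  also have "\<dots> \<le> num_le T v s" by (rule num_le_interlaced[OF assms(1,2)])
  finally show ?case using step.IH by simp
qed simp

lemma num_le_zero:
  assumes "T \<in> SSYT n lam"
  shows "num_le T 0 r = 0"
  using SSYT_rowD(2)[OF assms, of r] by (auto simp: num_le_def filter_empty_conv)

lemma num_le_top:
  assumes "T \<in> SSYT n lam" "n \<le> v"
  shows "num_le T v r = lam r"
proof -
  have "filter (\<lambda>x. x \<le> v) (T r) = T r"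
    using SSYT_rowD(2)[OF assms(1), of r] assms(2) by (auto simp: filter_id_conv)
  then show ?thesis using SSYT_rowD(1)[OF assms(1), of r] by (simp add: num_le_def)
qed

lemma num_le_below_diagonal:
  assumes "partition_le n lam" "T \<in> SSYT n lam" "v \<le> r"
  shows "num_le T v r = 0"
  using assms(3)
proof (induction v arbitrary: r)
  case 0
  then show ?case using num_le_zero[OF assms(2)] by simp
next
  case (Suc v)
  then obtain r' where "r = Suc r'" by (cases r) auto
  then show ?case
    using Suc num_le_interlaced[OF assms(1,2), of v r'] by fastforce
qed

lemma num_le_beyond:
  assumes "partition_le n lam" "T \<in> SSYT n lam" "n \<le> r"
  shows "num_le T v r = 0"
  using assms SSYT_rowD(1)[OF assms(2), of r] by (auto simp: num_le_def partition_le_def)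

text \<open>The numbers \<^term>\<open>num_le T v r\<close> are the partial sums of the contents of the rows, and the
  contents of a sorted row determine it.\<close>

lemma tableau_eqI:
  assumes T: "T \<in> SSYT n lam" and T': "T' \<in> SSYT n lam"
    and eq: "\<And>v r. v \<le> n \<Longrightarrow> num_le T v r = num_le T' v r"
  shows "T = T'"
proof
  fix r
  have "num_eq T v r = num_eq T' v r" for v
  proof (cases "v \<in> {1..n}")
    case True
    then obtain w where "v = Suc w" by (cases v) auto
    then show ?thesis
      using True eq[of v r] eq[of w r] num_le_Suc[of T w r] num_le_Suc[of T' w r] by simp
  next
    case False
    then have "v \<notin> set (T r)" "v \<notin> set (T' r)" using SSYT_rowD(2)[OF T] SSYT_rowD(2)[OF T'] by blast+
    then show ?thesis by (metis count_mset_0_iff)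
  qed
  then have "mset (T r) = mset (T' r)" by (simp add: multiset_eq_iff)
  then show "T r = T' r" using sorted_eq_if_mset_eq SSYT_rowD(3)[OF T] SSYT_rowD(3)[OF T'] by blast
qed

lemma mset_star [simp]: "mset ((T \<star> T') r) = mset (T r) + mset (T' r)"
  by (simp add: star_def)

lemma num_le_star [simp]: "num_le (T \<star> T') v r = num_le T v r + num_le T' v r"
  by (simp add: num_le_mset)

lemma partition_le_add:
  assumes "partition_le n lam" "partition_le n mu"
  shows "partition_le n (\<lambda>r. lam r + mu r)"
  using assms by (auto simp: partition_le_def antimono_def add_mono)

lemma star_in_SSYT:
  assumes lam: "partition_le n lam" and mu: "partition_le n mu"
    and T: "T \<in> SSYT n lam" and T': "T' \<in> SSYT n mu"
  shows "T \<star> T' \<in> SSYT n (\<lambda>r. lam r + mu r)"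
proof -
  have "length ((T \<star> T') r) = lam r + mu r" for r
    using SSYT_rowD(1)[OF T, of r] SSYT_rowD(1)[OF T', of r] by (simp add: star_def)
  moreover have "set ((T \<star> T') r) \<subseteq> {1..n}" for r
    using SSYT_rowD(2)[OF T, of r] SSYT_rowD(2)[OF T', of r] by (simp add: star_def)
  moreover have "sorted ((T \<star> T') r)" for r by (simp add: star_def)
  moreover have "num_le (T \<star> T') (Suc v) (Suc r) \<le> num_le (T \<star> T') v r" for v r
    using num_le_interlaced[OF lam T] num_le_interlaced[OF mu T'] by (simp add: add_mono)
  ultimately show ?thesis by (simp add: SSYT_iff_interlacing[OF partition_le_add[OF lam mu]])
qed

lemma inj_star: "inj_on (\<lambda>T. T \<star> T') (SSYT n lam)"
proof (rule inj_onI, rule ext)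
  fix S T r
  assume "S \<in> SSYT n lam" "T \<in> SSYT n lam" and eq: "S \<star> T' = T \<star> T'"
  then have "sorted (S r)" "sorted (T r)" by (auto simp: SSYT_def)
  moreover have "mset ((S \<star> T') r) = mset ((T \<star> T') r)" using eq by simp
  then have "mset (S r) = mset (T r)" by simp
  ultimately show "S r = T r" by (rule sorted_eq_if_mset_eq)
qed

section \<open>The row excess\<close>

text \<open>The bracket excess of the final part of the row reading word that starts with the entries
  \<open>i + 1\<close> of row \<open>r\<close>.\<close>

definition row_excess :: "nat \<Rightarrow> tableau \<Rightarrow> nat \<Rightarrow> int" where
  "row_excess i T r = (\<Sum>s<r. int (num_eq T (Suc i) s) - int (num_eq T i s)) + int (num_eq T (Suc i) r)"

text \<open>Below the tableau the excess is constant, so no row qualifies if the maximum is attained there.\<close>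

definition lowers_in_row :: "nat \<Rightarrow> tableau \<Rightarrow> nat \<Rightarrow> bool" where
  "lowers_in_row i T r \<longleftrightarrow>
     (\<forall>s. row_excess i T s \<le> row_excess i T r \<and> (r < s \<longrightarrow> row_excess i T s < row_excess i T r))"

text \<open>The bound 0 is the excess of the empty final part of the reading word.\<close>

definition raises_in_row :: "nat \<Rightarrow> tableau \<Rightarrow> nat \<Rightarrow> bool" where
  "raises_in_row i T r \<longleftrightarrow> 0 < row_excess i T r \<and>
     (\<forall>s. row_excess i T s \<le> row_excess i T r \<and> (s < r \<longrightarrow> row_excess i T s < row_excess i T r))"

definition switch :: "nat \<Rightarrow> nat \<Rightarrow> nat \<Rightarrow> tableau \<Rightarrow> tableau" where
  "switch r x y T = T(r := sort (y # remove1 x (T r)))"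

lemma row_excess_0: "row_excess i T 0 = int (num_eq T (Suc i) 0)"
  by (simp add: row_excess_def)

lemma row_excess_Suc:
  "row_excess i T (Suc r) = row_excess i T r + int (num_eq T (Suc i) (Suc r)) - int (num_eq T i r)"
  by (simp add: row_excess_def)

lemma row_excess_const:
  assumes "\<And>s. k \<le> s \<Longrightarrow> num_eq T i s = 0" "\<And>s. k < s \<Longrightarrow> num_eq T (Suc i) s = 0" "k \<le> r"
  shows "row_excess i T r = row_excess i T k"
  using assms(3) by (induction r rule: dec_induct) (auto simp: row_excess_Suc assms(1,2))

lemma lowers_in_row_count:
  assumes "lowers_in_row i T r"
  shows "num_eq T (Suc i) (Suc r) < num_eq T i r"
proof -
  have "row_excess i T (Suc r) < row_excess i T r" using assms by (simp add: lowers_in_row_def)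
  then show ?thesis by (simp add: row_excess_Suc)
qed

lemma raises_in_row_count:
  assumes "raises_in_row i T r"
  shows "0 < num_eq T (Suc i) r" "r \<noteq> 0 \<Longrightarrow> num_eq T i (r - 1) < num_eq T (Suc i) r"
proof -
  show *: "num_eq T i (r - 1) < num_eq T (Suc i) r" if "r \<noteq> 0"
  proof -
    have "row_excess i T (r - 1) < row_excess i T r" using assms that by (simp add: raises_in_row_def)
    then show ?thesis using row_excess_Suc[of i T "r - 1"] that by simp
  qed
  show "0 < num_eq T (Suc i) r"
  proof (cases "r = 0")
    case True
    then show ?thesis using assms by (simp add: raises_in_row_def row_excess_0)
  next
    case False
    from *[OF this] show ?thesis by linarith
  qed
qed

lemma lowers_in_row_mem: "lowers_in_row i T r \<Longrightarrow> i \<in> set (T r)"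
  using lowers_in_row_count[of i T r] by (metis count_mset_0_iff not_less_zero)

lemma raises_in_row_mem: "raises_in_row i T r \<Longrightarrow> Suc i \<in> set (T r)"
  using raises_in_row_count(1)[of i T r] by simp

section \<open>The bracket scan of the columns\<close>

text \<open>A column contains each letter at most once, and it is read upwards, so an \<open>i + 1\<close> comes directly
  before an \<open>i\<close> and cancels against it. Hence a whole column acts like at most one bracket.\<close>

lemma fold_bracket_column:
  assumes "sorted_wrt (\<lambda>p q. entry T q < entry T p) col"
  shows "(\<And>p. p \<in> set col \<Longrightarrow> entry T p \<noteq> i) \<Longrightarrow> (\<And>p. p \<in> set col \<Longrightarrow> entry T p \<noteq> Suc i)
           \<Longrightarrow> fold (bracket_step i T) col st = st"
    and "p \<in> set col \<Longrightarrow> entry T p = i \<Longrightarrow> q \<in> set col \<Longrightarrow> entry T q = Suc i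
           \<Longrightarrow> fold (bracket_step i T) col st = st"
    and "p \<in> set col \<Longrightarrow> entry T p = i \<Longrightarrow> (\<And>q. q \<in> set col \<Longrightarrow> entry T q \<noteq> Suc i)
           \<Longrightarrow> fold (bracket_step i T) col st = bracket_step i T p st"
    and "p \<in> set col \<Longrightarrow> entry T p = Suc i \<Longrightarrow> (\<And>q. q \<in> set col \<Longrightarrow> entry T q \<noteq> i)
           \<Longrightarrow> fold (bracket_step i T) col st = bracket_step i T p st"
proof -
  define ys where "ys = filter (\<lambda>p. entry T p = i \<or> entry T p = Suc i) col"
  have "fold (bracket_step i T) xs st
      = fold (bracket_step i T) (filter (\<lambda>p. entry T p = i \<or> entry T p = Suc i) xs) st" for xs st
    by (induction xs arbitrary: st) auto
  then have fold: "fold (bracket_step i T) col st = fold (bracket_step i T) ys st"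
    by (simp only: ys_def)
  have sorted: "sorted_wrt (\<lambda>p q. entry T q < entry T p) ys"
    using assms by (simp add: ys_def sorted_wrt_filter)
  have ys: "entry T p = i \<or> entry T p = Suc i" if "p \<in> set ys" for p
    using that by (simp add: ys_def)
  have mem: "p \<in> set ys" if "p \<in> set col" "entry T p = i \<or> entry T p = Suc i" for p
    using that by (simp add: ys_def)
  have sub: "p \<in> set col" if "p \<in> set ys" for p
    using that by (simp add: ys_def)
  consider "ys = []" | p where "ys = [p]" | p q where "ys = [p, q]" "entry T p = Suc i" "entry T q = i"
  proof (cases ys)
    case (Cons p ys')
    note ys_Cons = this
    show ?thesis
    proof (cases ys')
      case Nil
      then show ?thesis using ys_Cons that by blast
    next
      case (Cons q ys'')
      have "ys'' = []"
      proof (rule ccontr)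
        assume "ys'' \<noteq> []"
        then obtain x zs where "ys = p # q # x # zs" using ys_Cons Cons by (cases ys'') auto
        then show False using sorted ys[of p] ys[of q] ys[of x] by auto
      qed
      then have "ys = [p, q]" using ys_Cons Cons by simp
      moreover from this have "entry T p = Suc i" "entry T q = i"
        using sorted ys[of p] ys[of q] by auto
      ultimately show ?thesis using that by blast
    qed
  qed (use that in blast)
  note cases = this
  show "fold (bracket_step i T) col st = st"
    if "\<And>p. p \<in> set col \<Longrightarrow> entry T p \<noteq> i" "\<And>p. p \<in> set col \<Longrightarrow> entry T p \<noteq> Suc i"
    using that ys sub by (cases rule: cases) (auto simp: fold)
  show "fold (bracket_step i T) col st = st"
    if "p \<in> set col" "entry T p = i" "q \<in> set col" "entry T q = Suc i"
    using mem[of p] mem[of q] that by (cases rule: cases) (auto simp: fold)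
  show "fold (bracket_step i T) col st = bracket_step i T p st"
    if "p \<in> set col" "entry T p = i" "\<And>q. q \<in> set col \<Longrightarrow> entry T q \<noteq> Suc i"
    using mem[of p] that(1,2) that(3)[OF sub]
    by (cases rule: cases) (auto simp: fold simp del: bracket_step.simps)
  show "fold (bracket_step i T) col st = bracket_step i T p st"
    if "p \<in> set col" "entry T p = Suc i" "\<And>q. q \<in> set col \<Longrightarrow> entry T q \<noteq> i"
    using mem[of p] that(1,2) that(3)[OF sub]
    by (cases rule: cases) (auto simp: fold simp del: bracket_step.simps)
qed

text \<open>For a height function \<open>K\<close> on the boundaries between columns, where column \<open>d\<close> lies between the
  boundaries \<open>d\<close> and \<open>d + 1\<close>: the step across the column of \<open>p\<close> reaches the maximum \<open>m\<close> for the first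
  time, or leaves it for the last time among the boundaries up to \<open>c\<close>.\<close>

definition ends_first_max :: "(nat \<Rightarrow> int) \<Rightarrow> tableau \<Rightarrow> int \<Rightarrow> cell \<Rightarrow> bool" where
  "ends_first_max K T m p \<longleftrightarrow> snd p < length (T (fst p)) \<and>
     K (Suc (snd p)) = m \<and> (\<forall>d\<le>snd p. K d < m)"

definition starts_last_max :: "(nat \<Rightarrow> int) \<Rightarrow> tableau \<Rightarrow> nat \<Rightarrow> int \<Rightarrow> cell \<Rightarrow> bool" where
  "starts_last_max K T c m p \<longleftrightarrow> snd p < length (T (fst p)) \<and>
     K (snd p) = m \<and> (\<forall>d. snd p < d \<and> d \<le> c \<longrightarrow> K d < m)"

text \<open>If \<open>K\<close> rises by one across a closing bracket and falls by one across an opening bracket, then a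
  closing bracket stays unmatched exactly if it takes \<open>K\<close> to a new maximum. So the scan has
  \<open>m - K 0\<close> unmatched closing brackets \<open>cs\<close> and \<open>m - K c\<close> unmatched opening brackets \<open>os\<close>, where \<open>m\<close> is the
  maximum so far. The scan puts the most recent letter first, so the rightmost unmatched closing
  bracket is the head of \<open>cs\<close>, and the leftmost unmatched opening bracket is the last entry of \<open>os\<close>.
  They are the steps into the first maximum and out of the last one.\<close>

definition scan_invariant ::
    "(nat \<Rightarrow> int) \<Rightarrow> nat \<Rightarrow> tableau \<Rightarrow> nat \<Rightarrow> int \<Rightarrow> cell list \<Rightarrow> cell list \<Rightarrow> bool" where
  "scan_invariant K i T c m os cs \<longleftrightarrow>
     (\<forall>p\<in>set os. entry T p = Suc i) \<and> (\<forall>p\<in>set cs. entry T p = i) \<and>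
     int (length os) = m - K c \<and> int (length cs) = m - K 0 \<and> (\<forall>d\<le>c. K d \<le> m) \<and>
     (cs \<noteq> [] \<longrightarrow> ends_first_max K T m (hd cs)) \<and>
     (os \<noteq> [] \<longrightarrow> starts_last_max K T c m (last os))"

lemma starts_last_max_Suc:
  "starts_last_max K T c m p \<Longrightarrow> K (Suc c) < m \<Longrightarrow> starts_last_max K T (Suc c) m p"
  unfolding starts_last_max_def by (metis le_Suc_eq)

lemma scan_invariant_stay:
  assumes inv: "scan_invariant K i T c m os cs" and K: "K (Suc c) = K c"
  shows "scan_invariant K i T (Suc c) m os cs"
proof -
  have "K (Suc c) < m" if "os \<noteq> []"
    using that inv K by (cases os) (simp_all add: scan_invariant_def)
  moreover have "\<forall>d\<le>Suc c. K d \<le> m"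
    using inv K unfolding scan_invariant_def by (metis le_Suc_eq order_refl)
  ultimately show ?thesis
    using inv K starts_last_max_Suc unfolding scan_invariant_def by simp
qed

lemma scan_invariant_open:
  assumes inv: "scan_invariant K i T c m os cs" and K: "K (Suc c) = K c - 1"
    and p: "c < length (T r)" "entry T (r, c) = Suc i"
  shows "scan_invariant K i T (Suc c) m ((r, c) # os) cs"
proof -
  have "K c \<le> m" using inv by (simp add: scan_invariant_def)
  then have less: "K (Suc c) < m" using K by simp
  then have "\<forall>d\<le>Suc c. K d \<le> m"
    using inv unfolding scan_invariant_def by (metis le_Suc_eq less_imp_le)
  moreover have "starts_last_max K T (Suc c) m (last ((r, c) # os))"
  proof (cases "os = []")
    case True
    then have "K c = m" using inv by (simp add: scan_invariant_def)
    moreover have "K d < m" if "c < d" "d \<le> Suc c" for d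
      using that less by (metis Suc_leI le_antisym)
    ultimately show ?thesis using True p(1) by (simp add: starts_last_max_def)
  next
    case False
    then show ?thesis
      using inv less starts_last_max_Suc by (simp add: scan_invariant_def)
  qed
  ultimately show ?thesis
    using inv K p unfolding scan_invariant_def by simp
qed

lemma scan_invariant_close:
  assumes inv: "scan_invariant K i T c m os cs" and K: "K (Suc c) = K c + 1"
    and p: "c < length (T r)" "entry T (r, c) = i"
  shows "\<exists>m' os' cs'. bracket_step i T (r, c) (os @ cs) = os' @ cs' \<and>
    scan_invariant K i T (Suc c) m' os' cs'"
proof (cases os)
  case Nil
  then have m: "K c = m" using inv by (simp add: scan_invariant_def)
  then have le: "K d < m + 1" if "d \<le> c" for d
    using inv that unfolding scan_invariant_def by (metis zle_add1_eq_le)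
  have "bracket_step i T (r, c) (os @ cs) = [] @ ((r, c) # cs)"
    using Nil inv p by (cases cs) (simp_all add: scan_invariant_def)
  moreover have "ends_first_max K T (m + 1) (r, c)"
    using p le K m by (simp add: ends_first_max_def)
  moreover have "\<forall>d\<le>Suc c. K d \<le> m + 1" using le K m by (metis le_Suc_eq less_imp_le order_refl)
  ultimately have "scan_invariant K i T (Suc c) (m + 1) [] ((r, c) # cs)"
    using Nil inv p K m unfolding scan_invariant_def by simp
  then show ?thesis using \<open>bracket_step i T (r, c) (os @ cs) = _\<close> by blast
next
  case (Cons q os')
  then have q: "entry T q = Suc i" using inv by (simp add: scan_invariant_def)
  have len: "int (length os') = m - K (Suc c)" using Cons inv K by (simp add: scan_invariant_def)
  have "starts_last_max K T (Suc c) m (last os')" if "os' \<noteq> []"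
  proof (rule starts_last_max_Suc)
    show "K (Suc c) < m" using that len by (cases os') auto
    show "starts_last_max K T c m (last os')" using that Cons inv by (simp add: scan_invariant_def)
  qed
  moreover have "\<forall>d\<le>Suc c. K d \<le> m"
    using inv len unfolding scan_invariant_def by (metis diff_ge_0_iff_ge le_Suc_eq of_nat_0_le_iff)
  ultimately have "scan_invariant K i T (Suc c) m os' cs"
    using Cons inv len unfolding scan_invariant_def by simp
  moreover have "bracket_step i T (r, c) (os @ cs) = os' @ cs" using Cons p q by simp
  ultimately show ?thesis by metis
qed

text \<open>The number of entries \<open>i + 1\<close> minus the number of entries \<open>i\<close> in the columns from \<open>c\<close> on. With
  truncated subtraction, \<open>num_le T v s - c\<close> counts the entries at most \<open>v\<close> of row \<open>s\<close> in these columns.\<close>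

definition column_excess :: "nat \<Rightarrow> nat \<Rightarrow> tableau \<Rightarrow> nat \<Rightarrow> int" where
  "column_excess n i T c =
     (\<Sum>s\<le>n. int (num_le T (Suc i) s - c) - 2 * int (num_le T i s - c) + int (num_le T (i - 1) s - c))"

definition column_cells :: "nat \<Rightarrow> tableau \<Rightarrow> nat \<Rightarrow> cell list" where
  "column_cells n T c = map (\<lambda>r. (r, c)) (filter (\<lambda>r. c < length (T r)) (rev [0..<n]))"

lemma reading_cells_columns:
  "reading_cells n T = concat (map (column_cells n T) [0..<length (T 0)])"
proof -
  have "concat (map (\<lambda>r. if P r then [f r] else []) xs) = map f (filter P xs)"
    for P and f :: "nat \<Rightarrow> cell" and xs
    by (induction xs) auto
  then show ?thesis unfolding reading_cells_def column_cells_def by simp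
qed

lemma sum_of_bool_unique:
  assumes "finite A" "\<And>x. P x \<Longrightarrow> x \<in> A" "\<And>x y. P x \<Longrightarrow> P y \<Longrightarrow> x = y"
  shows "(\<Sum>x\<in>A. of_bool (P x)) = (of_bool (\<exists>x. P x) :: int)"
proof (cases "\<exists>x. P x")
  case True
  then obtain y where "P y" by blast
  then have "(\<Sum>x\<in>A. of_bool (P x)) = (\<Sum>x\<in>A. if x = y then 1 else 0 :: int)"
    using assms(3) by (intro sum.cong) auto
  then show ?thesis using \<open>P y\<close> assms(1,2) by auto
qed simp

context
  fixes n :: nat and lam :: "nat \<Rightarrow> nat" and T :: tableau
  assumes lam: "partition_le n lam" and T: "T \<in> SSYT n lam"
begin


lemma lam_antimono: "r \<le> s \<Longrightarrow> lam s \<le> lam r"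
  using lam by (auto simp: partition_le_def antimono_def)

lemma column_strict:
  assumes "r < s" "c < lam s"
  shows "T r ! c < T s ! c"
  using assms
proof (induction s)
  case (Suc s)
  then have "c < lam s" using lam_antimono[of s "Suc s"] by simp
  moreover have "T s ! c < T (Suc s) ! c" using T Suc.prems by (simp add: SSYT_def)
  ultimately show ?case using Suc by (cases "r = s") auto
qed simp

lemma column_entry_unique:
  assumes "c < lam r" "c < lam s" "T r ! c = T s ! c"
  shows "r = s"
  using assms column_strict[of r s c] column_strict[of s r c] by (metis linorder_neqE_nat less_irrefl)

lemma row_bound: "c < lam r \<Longrightarrow> r < n"
  using lam unfolding partition_le_def by (metis not_less not_less0)

lemma column_cells_strict: "sorted_wrt (\<lambda>p q. entry T q < entry T p) (column_cells n T c)"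
proof -
  have "sorted_wrt (\<lambda>r s. s < r) (filter (\<lambda>r. c < length (T r)) (rev [0..<n]))"
    by (intro sorted_wrt_filter) (simp add: sorted_wrt_rev)
  then show ?thesis
    unfolding column_cells_def sorted_wrt_map
    by (rule sorted_wrt_mono_rel[rotated])
      (auto simp: entry_def SSYT_rowD(1)[OF T] intro: column_strict)
qed

lemma column_cells_iff: "p \<in> set (column_cells n T c) \<longleftrightarrow> snd p = c \<and> c < lam (fst p)"
  using row_bound by (cases p) (auto simp: column_cells_def SSYT_rowD(1)[OF T])

lemma num_le_row_order:
  assumes "r < s"
  shows "num_le T (Suc v) s \<le> num_le T v r"
  using num_le_antimono[OF lam T, of "Suc r" s "Suc v"] num_le_interlaced[OF lam T, of v r] assms
  by simp

context
  fixes i :: nat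
  assumes i: "1 \<le> i"
begin

lemma column_excess_Suc:
  "column_excess n i T (Suc c) = column_excess n i T c
     + of_bool (\<exists>r. c < lam r \<and> T r ! c = i) - of_bool (\<exists>r. c < lam r \<and> T r ! c = Suc i)"
proof -
  have *: "int (x - Suc c) = int (x - c) - of_bool (c < x)" for x by auto
  have eq: "of_bool (c < lam s \<and> T s ! c = v) = (of_bool (c < num_le T v s) - of_bool (c < num_le T (v - 1) s) :: int)"
    if "1 \<le> v" for v s
    using nth_eq_iff[OF T that, of c s] num_le_mono[of "v - 1" v T s] by auto
  have "column_excess n i T (Suc c) - column_excess n i T c
      = (\<Sum>s\<le>n. of_bool (c < lam s \<and> T s ! c = i) - of_bool (c < lam s \<and> T s ! c = Suc i))"
    unfolding column_excess_def sum_subtractf[symmetric] eq[OF i] eq[of "Suc i", simplified] *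
    by (intro sum.cong) auto
  also have "\<dots> = of_bool (\<exists>r. c < lam r \<and> T r ! c = i) - of_bool (\<exists>r. c < lam r \<and> T r ! c = Suc i)"
  proof -
    have "(\<Sum>s\<le>n. of_bool (c < lam s \<and> T s ! c = v)) = (of_bool (\<exists>r. c < lam r \<and> T r ! c = v) :: int)" for v
      by (rule sum_of_bool_unique) (use row_bound column_entry_unique in \<open>auto dest: less_imp_le\<close>)
    then show ?thesis by (simp add: sum_subtractf)
  qed
  finally show ?thesis by simp
qed

lemma scan_columns:
  "\<exists>m os cs. fold (bracket_step i T) (concat (map (column_cells n T) [0..<c])) [] = os @ cs \<and>
     scan_invariant (column_excess n i T) i T c m os cs"
proof (induction c)
  case 0
  have "scan_invariant (column_excess n i T) i T 0 (column_excess n i T 0) [] []"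
    by (simp add: scan_invariant_def)
  then show ?case by fastforce
next
  case (Suc c)
  let ?K = "column_excess n i T"
  obtain m os cs where st: "fold (bracket_step i T) (concat (map (column_cells n T) [0..<c])) [] = os @ cs"
    and inv: "scan_invariant ?K i T c m os cs"
    using Suc by blast
  have fold: "fold (bracket_step i T) (concat (map (column_cells n T) [0..<Suc c])) []
      = fold (bracket_step i T) (column_cells n T c) (os @ cs)"
    using st by simp
  have ex: "(\<exists>r. c < lam r \<and> T r ! c = v) \<longleftrightarrow> (\<exists>p\<in>set (column_cells n T c). entry T p = v)" for v
    unfolding column_cells_iff Bex_def entry_def by force
  have K: "?K (Suc c) = ?K c + of_bool (\<exists>p\<in>set (column_cells n T c). entry T p = i)
      - of_bool (\<exists>p\<in>set (column_cells n T c). entry T p = Suc i)"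
    unfolding column_excess_Suc ex ..
  have cell: "\<exists>r. p = (r, c) \<and> c < length (T r)" if "p \<in> set (column_cells n T c)" for p
    using that column_cells_iff[of p c] SSYT_rowD(1)[OF T] by (metis prod.collapse)
  note column = fold_bracket_column[OF column_cells_strict[of c], where i = i]
  show ?case
  proof (cases "\<exists>p\<in>set (column_cells n T c). entry T p = i")
    case True
    then obtain p where p: "p \<in> set (column_cells n T c)" "entry T p = i" by blast
    show ?thesis
    proof (cases "\<exists>q\<in>set (column_cells n T c). entry T q = Suc i")
      case both: True
      then obtain q where q: "q \<in> set (column_cells n T c)" "entry T q = Suc i" by blast
      have "?K (Suc c) = ?K c" using K True both by simp
      then show ?thesis
        unfolding fold column(2)[OF p q] using scan_invariant_stay[OF inv] by blast
    next
      case False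
      obtain r where r: "p = (r, c)" "c < length (T r)" using cell p(1) by blast
      have "?K (Suc c) = ?K c + 1" using K True False by simp
      from scan_invariant_close[OF inv this r(2)] p(2) r(1)
      obtain m' os' cs' where "bracket_step i T p (os @ cs) = os' @ cs'"
        "scan_invariant ?K i T (Suc c) m' os' cs'" by blast
      moreover have "fold (bracket_step i T) (column_cells n T c) (os @ cs)
          = bracket_step i T p (os @ cs)"
        using column(3)[OF p] False by blast
      ultimately show ?thesis unfolding fold by metis
    qed
  next
    case no: False
    show ?thesis
    proof (cases "\<exists>q\<in>set (column_cells n T c). entry T q = Suc i")
      case True
      then obtain q where q: "q \<in> set (column_cells n T c)" "entry T q = Suc i" by blast
      obtain r where r: "q = (r, c)" "c < length (T r)" using cell q(1) by blast
      have "?K (Suc c) = ?K c - 1" using K True no by simp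
      from scan_invariant_open[OF inv this r(2)] q(2) r(1)
      have "scan_invariant ?K i T (Suc c) m (q # os) cs" by simp
      moreover have "fold (bracket_step i T) (column_cells n T c) (os @ cs) = (q # os) @ cs"
        using column(4)[OF q] no q(2) by simp
      ultimately show ?thesis unfolding fold by blast
    next
      case False
      have "?K (Suc c) = ?K c" using K False no by simp
      moreover have "fold (bracket_step i T) (column_cells n T c) (os @ cs) = os @ cs"
        using False no by (intro column(1)) auto
      ultimately show ?thesis
        unfolding fold using scan_invariant_stay[OF inv] by auto
    qed
  qed
qed

text \<open>Let \<open>c\<close> lie between the ends of the entries at most \<open>i\<close> of the rows \<open>r\<close> and \<open>r - 1\<close>. By interlacing,
  the letters \<open>i\<close> and \<open>i + 1\<close> of the rows before \<open>r - 1\<close> all lie in the columns from \<open>c\<close> on and those of the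
  rows after \<open>r\<close> all lie in the columns before \<open>c\<close>. Only the entries \<open>i + 1\<close> of row \<open>r\<close> and
  the entries \<open>i\<close> of row \<open>r - 1\<close> may be cut. The result is a convex function of \<open>c\<close>.\<close>

lemma column_excess_between:
  assumes r: "r \<le> n" "num_le T i r \<le> c" and c: "r = 0 \<or> c \<le> num_le T i (r - 1)"
  shows "column_excess n i T c = row_excess i T r - int (num_eq T (Suc i) r)
    + int (num_le T (Suc i) r - c) + (if r = 0 then 0 else int (c - num_le T (i - 1) (r - 1)))"
proof -
  have rowwise: "int (num_le T (Suc i) s - c) - 2 * int (num_le T i s - c) + int (num_le T (i - 1) s - c)
     = (if s < r then int (num_eq T (Suc i) s) - int (num_eq T i s) else 0)
       + (if s = r then int (num_le T (Suc i) r - c) else 0)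
       + (if s = r - 1 then (if r = 0 then 0 else int (c - num_le T (i - 1) (r - 1))) else 0)" for s
  proof -
    have mono: "num_le T (i - 1) s \<le> num_le T i s" "num_le T i s \<le> num_le T (Suc i) s"
      by (auto intro: num_le_mono)
    consider "Suc s < r" | "r = Suc s" | "s = r" | "r < s" by linarith
    then show ?thesis
    proof cases
      case 1
      then have "num_le T i (r - 1) \<le> num_le T (i - 1) s"
        using num_le_row_order[of s "r - 1" "i - 1"] i by simp
      then have "c \<le> num_le T (i - 1) s" using c 1 by simp
      then show ?thesis using 1 mono by (simp add: num_eq_diff[OF i] of_nat_diff)
    next
      case 2
      then have "c \<le> num_le T i s" using c by simp
      then show ?thesis using 2 mono by (auto simp: num_eq_diff[OF i] of_nat_diff)
    next
      case 3
      then show ?thesis using r mono by auto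
    next
      case 4
      then have "num_le T (Suc i) s \<le> c" using num_le_row_order[of r s i] r by simp
      then show ?thesis using 4 mono by auto
    qed
  qed
  have "(\<Sum>s\<le>n. if s < r then int (num_eq T (Suc i) s) - int (num_eq T i s) else 0)
      = (\<Sum>s<r. int (num_eq T (Suc i) s) - int (num_eq T i s))"
    using r(1) by (intro sum.mono_neutral_cong_right) auto
  moreover have "r - 1 \<le> n" using r(1) by simp
  ultimately show ?thesis
    unfolding column_excess_def rowwise using r(1)
    by (simp add: sum.distrib row_excess_def)
qed

text \<open>The boundary after the last entry \<open>i\<close> of a row is where the column reading and the row reading
  have the same excess.\<close>

lemma column_excess_num_le:
  assumes "r \<le> n"
  shows "column_excess n i T (num_le T i r) = row_excess i T r"
proof -
  have "num_le T i r \<le> num_le T (i - 1) (r - 1)" if "r \<noteq> 0"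
    using num_le_row_order[of "r - 1" r "i - 1"] that i by simp
  moreover have "num_le T (i - 1) (r - 1) \<le> num_le T i (r - 1)" by (rule num_le_mono) simp
  ultimately show ?thesis
    using column_excess_between[OF assms order_refl] num_eq_diff(2)[OF i, of T r]
      num_le_mono[of i "Suc i" T r]
    by (cases "r = 0") (auto simp: of_nat_diff)
qed

end

end

lemma set_entry_eq_switch:
  assumes "c < length (T r)" "T r ! c = x" "sorted ((T r)[c := y])"
  shows "set_entry T (r, c) y = switch r x y T"
proof -
  have "mset ((T r)[c := y]) = mset (y # remove1 x (T r))"
    using assms(1,2) by (simp add: mset_update)
  then have "sort (y # remove1 x (T r)) = (T r)[c := y]"
    using assms(3) by (metis properties_for_sort)
  then show ?thesis by (simp add: set_entry_def switch_def)
qed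

section \<open>Crystal operators in terms of rows\<close>

lemma int_diff_max: "int (x - y) = max 0 (int x - int y)"
  by (simp add: of_nat_diff max_def)

lemma exists_last_max:
  fixes g :: "nat \<Rightarrow> int"
  assumes "\<And>s. n \<le> s \<Longrightarrow> g s = g n" and "g n < g k"
  shows "\<exists>r. \<forall>s. g s \<le> g r \<and> (r < s \<longrightarrow> g s < g r)"
proof -
  define m where "m = Max (g ` {..n})"
  have le: "g s \<le> m" for s
  proof (cases "s \<le> n")
    case False
    then have "g s = g n" by (intro assms(1)) simp
    then show ?thesis by (simp add: m_def)
  qed (simp add: m_def)
  have "m \<in> g ` {..n}" unfolding m_def by (rule Max_in) auto
  then have ex: "\<exists>r. g r = m" by auto
  have bound: "r \<le> n" if "g r = m" for r
    using that assms(1)[of r] assms(2) le[of k] by (cases "r \<le> n") simp_all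
  define r where "r = (GREATEST r. g r = m)"
  have r: "g r = m" unfolding r_def using ex bound by (metis (mono_tags, lifting) GreatestI_nat)
  have "s \<le> r" if "g s = m" for s
    unfolding r_def by (rule Greatest_le_nat[of _ _ n]) (use that bound in auto)
  then have "g s < g r" if "r < s" for s using that le[of s] r by (metis leD order_le_less)
  then show ?thesis using le r by (intro exI[of _ r]) simp
qed

lemma exists_first_max:
  fixes g :: "nat \<Rightarrow> int"
  assumes "\<And>s. n \<le> s \<Longrightarrow> g s = g n"
  shows "\<exists>r. \<forall>s. g s \<le> g r \<and> (s < r \<longrightarrow> g s < g r)"
proof -
  define m where "m = Max (g ` {..n})"
  have le: "g s \<le> m" for s
  proof (cases "s \<le> n")
    case False
    then have "g s = g n" by (intro assms) simp
    then show ?thesis by (simp add: m_def)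
  qed (simp add: m_def)
  have "m \<in> g ` {..n}" unfolding m_def by (rule Max_in) auto
  then have "\<exists>r. g r = m" by auto
  then obtain r where "g r = m" "\<And>s. s < r \<Longrightarrow> g s \<noteq> m"
    using exists_least_iff[of "\<lambda>r. g r = m"] by blast
  then show ?thesis using le by (intro exI[of _ r]) (simp add: order_less_le)
qed

context
  fixes n i :: nat and lam :: "nat \<Rightarrow> nat" and T :: tableau
  assumes lam: "partition_le n lam" and T: "T \<in> SSYT n lam" and i: "1 \<le> i"
begin

lemma row_excess_beyond:
  assumes "n \<le> r"
  shows "row_excess i T r = row_excess i T n"
proof (rule row_excess_const)
  have "num_eq T v s = 0" if "n \<le> s" for v s
    using that SSYT_rowD(1)[OF T, of s] lam by (simp add: partition_le_def)
  then show "num_eq T i s = 0" if "n \<le> s" for s using that by simp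
  show "num_eq T (Suc i) s = 0" if "n < s" for s
    using that \<open>\<And>v s. n \<le> s \<Longrightarrow> num_eq T v s = 0\<close> by simp
qed (rule assms)

lemma column_between_rows:
  "\<exists>r\<le>n. num_le T i r \<le> c \<and> (r = 0 \<or> c < num_le T i (r - 1))"
proof -
  have n: "num_le T i n \<le> c" using num_le_beyond[OF lam T, of n] by simp
  define r where "r = (LEAST r. num_le T i r \<le> c)"
  have "num_le T i r \<le> c" unfolding r_def using n by (rule LeastI)
  moreover have "r \<le> n" unfolding r_def using n by (rule Least_le)
  moreover have "c < num_le T i (r - 1)" if "r \<noteq> 0"
    using not_less_Least[of "r - 1" "\<lambda>r. num_le T i r \<le> c"] that by (auto simp: r_def)
  ultimately show ?thesis by (intro exI[of _ r]) auto
qed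

text \<open>By convexity the column excess between two such boundaries is bounded by the row excesses at the
  boundaries. So it attains its maximum at the end of the entries \<open>i\<close> of some row, and the first and
  last maxima of the column excess correspond to the last and first maxima of the row excess.\<close>

lemma column_excess_bound:
  assumes r: "r \<le> n" "num_le T i r \<le> c" "r = 0 \<or> c < num_le T i (r - 1)"
  shows "column_excess n i T c \<le> row_excess i T r
    \<or> r \<noteq> 0 \<and> column_excess n i T c < row_excess i T (r - 1)"
proof -
  have eq: "column_excess n i T c = row_excess i T r - int (num_eq T (Suc i) r)
    + int (num_le T (Suc i) r - c) + (if r = 0 then 0 else int (c - num_le T (i - 1) (r - 1)))"
    using column_excess_between[OF lam T i r(1,2)] r(3) by auto
  have b: "int (num_eq T (Suc i) r) = int (num_le T (Suc i) r) - int (num_le T i r)"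
    "int (num_eq T i (r - 1)) = int (num_le T i (r - 1)) - int (num_le T (i - 1) (r - 1))"
    using num_eq_diff[OF i] by blast+
  have "num_le T i r \<le> num_le T (Suc i) r" by (rule num_le_mono) simp
  show ?thesis
  proof (cases "r = 0")
    case True
    then show ?thesis using eq b(1) r(2) \<open>num_le T i r \<le> num_le T (Suc i) r\<close> by auto
  next
    case False
    have "num_le T i r \<le> num_le T (i - 1) (r - 1)"
      using num_le_row_order[OF lam T, of "r - 1" r "i - 1"] False i by simp
    moreover have "row_excess i T r
        = row_excess i T (r - 1) + int (num_eq T (Suc i) r) - int (num_eq T i (r - 1))"
      using False row_excess_Suc[of i T "r - 1"] by simp
    ultimately show ?thesis
      using eq b r(2,3) False \<open>num_le T i r \<le> num_le T (Suc i) r\<close>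
      unfolding int_diff_max if_not_P[OF False] by linarith
  qed
qed

lemma column_excess_le_row_excess: "\<exists>r. column_excess n i T c \<le> row_excess i T r"
proof -
  obtain r where "r \<le> n" "num_le T i r \<le> c" "r = 0 \<or> c < num_le T i (r - 1)"
    using column_between_rows[of c] by blast
  from column_excess_bound[OF this] show ?thesis by (meson less_imp_le)
qed

lemma lowers_in_row_bound: "lowers_in_row i T r \<Longrightarrow> r < n"
  using row_excess_beyond[of r] row_excess_beyond[of "Suc r"]
  by (metis le_SucI lessI less_irrefl lowers_in_row_def not_less)

lemma raises_in_row_bound: "raises_in_row i T r \<Longrightarrow> r < n"
proof (rule ccontr)
  assume r: "raises_in_row i T r" and "\<not> r < n"
  then have "T r = []" using SSYT_rowD(1)[OF T, of r] lam by (simp add: partition_le_def)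
  then show False using raises_in_row_count(1)[OF r] by simp
qed

lemma lowers_in_row_peak:
  assumes "lowers_in_row i T r"
  shows "column_excess n i T c \<le> row_excess i T r"
    and "c < num_le T i r \<Longrightarrow> column_excess n i T c < row_excess i T r"
proof -
  show "column_excess n i T c \<le> row_excess i T r"
    using column_excess_le_row_excess[of c] assms unfolding lowers_in_row_def by (metis order_trans)
  show "column_excess n i T c < row_excess i T r" if "c < num_le T i r"
  proof -
    obtain q where q: "q \<le> n" "num_le T i q \<le> c" "q = 0 \<or> c < num_le T i (q - 1)"
      using column_between_rows[of c] by blast
    have "r < q"
      using q(2) that num_le_antimono[OF lam T, of q r i] by (metis leD le_trans not_less)
    then have "row_excess i T q < row_excess i T r" "row_excess i T (q - 1) \<le> row_excess i T r"
      using assms by (simp_all add: lowers_in_row_def)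
    then show ?thesis using column_excess_bound[OF q] by auto
  qed
qed

lemma raises_in_row_peak:
  assumes r: "raises_in_row i T r"
  shows "column_excess n i T c \<le> row_excess i T r"
    and "num_le T i r < c \<Longrightarrow> column_excess n i T c < row_excess i T r"
proof -
  show "column_excess n i T c \<le> row_excess i T r"
    using column_excess_le_row_excess[of c] assms unfolding raises_in_row_def by (metis order_trans)
  show "column_excess n i T c < row_excess i T r" if c: "num_le T i r < c"
  proof -
    obtain q where q: "q \<le> n" "num_le T i q \<le> c" "q = 0 \<or> c < num_le T i (q - 1)"
      using column_between_rows[of c] by blast
    have "\<not> r < q"
    proof
      assume "r < q"
      then have "num_le T i (q - 1) \<le> num_le T i r" by (intro num_le_antimono[OF lam T]) simp
      then show False using q(3) c \<open>r < q\<close> by simp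
    qed
    then consider "q < r" | "q = r" by linarith
    then show ?thesis
    proof cases
      case 1
      then have "row_excess i T q < row_excess i T r" "row_excess i T (q - 1) < row_excess i T r"
        using r by (simp_all add: raises_in_row_def)
      then show ?thesis using column_excess_bound[OF q] by auto
    next
      case 2
      have eq: "column_excess n i T c = row_excess i T r - int (num_eq T (Suc i) r)
        + int (num_le T (Suc i) r - c) + (if r = 0 then 0 else int (c - num_le T (i - 1) (r - 1)))"
        using column_excess_between[OF lam T i q(1,2)] q(3) 2 by auto
      have b: "int (num_eq T (Suc i) r) = int (num_le T (Suc i) r) - int (num_le T i r)"
        "int (num_eq T i (r - 1)) = int (num_le T i (r - 1)) - int (num_le T (i - 1) (r - 1))"
        using num_eq_diff[OF i] by blast+
      note count = raises_in_row_count[OF r]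
      show ?thesis
      proof (cases "r = 0")
        case True
        then show ?thesis using eq b(1) count(1) c unfolding int_diff_max if_P[OF True] by linarith
      next
        case False
        have "num_le T (Suc i) r \<le> num_le T i (r - 1)"
          using num_le_row_order[OF lam T, of "r - 1" r i] False by simp
        moreover have "c < num_le T i (r - 1)" using q(3) 2 False by simp
        ultimately show ?thesis
          using eq b count(1) count(2)[OF False] c
          unfolding int_diff_max if_not_P[OF False] by linarith
      qed
    qed
  qed
qed

lemma unmatched_cells_scan:
  obtains m os cs where
    "filter (\<lambda>p. entry T p = i) (unmatched_cells n i T) = rev cs"
    "filter (\<lambda>p. entry T p = Suc i) (unmatched_cells n i T) = rev os"
    "scan_invariant (column_excess n i T) i T (lam 0) m os cs"
proof -
  obtain m os cs where
    fold: "fold (bracket_step i T) (concat (map (column_cells n T) [0..<lam 0])) [] = os @ cs"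
    and inv: "scan_invariant (column_excess n i T) i T (lam 0) m os cs"
    using scan_columns[OF lam T i] by blast
  have "unmatched_cells n i T = rev cs @ rev os"
    using fold by (simp add: unmatched_cells_def reading_cells_columns SSYT_rowD(1)[OF T])
  moreover have "\<forall>p\<in>set os. entry T p = Suc i" "\<forall>p\<in>set cs. entry T p = i"
    using inv by (simp_all add: scan_invariant_def)
  ultimately have
    "filter (\<lambda>p. entry T p = i) (unmatched_cells n i T) = rev cs"
    "filter (\<lambda>p. entry T p = Suc i) (unmatched_cells n i T) = rev os"
    by (auto simp: filter_empty_conv filter_id_conv)
  then show ?thesis using inv that by blast
qed

lemma num_le_bound: "num_le T v r \<le> lam 0"
  using num_le_antimono[OF lam T, of 0 r v] nth_le_iff[OF T, of "lam 0" v 0] by auto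

text \<open>The step of the column excess into its first maximum is across the cell with the last entry \<open>i\<close> of
  row \<open>r\<close>, as row \<open>r\<close> is the last, hence leftmost, row with maximal excess.\<close>

lemma f_op_Some:
  assumes r: "lowers_in_row i T r"
  shows "f_op n i T = Some (switch r i (Suc i) T)"
proof -
  let ?K = "column_excess n i T"
  obtain m os cs where cs: "filter (\<lambda>p. entry T p = i) (unmatched_cells n i T) = rev cs"
    and inv: "scan_invariant ?K i T (lam 0) m os cs"
    by (rule unmatched_cells_scan)
  have K: "?K (num_le T i r) = row_excess i T r"
    using column_excess_num_le[OF lam T i] lowers_in_row_bound[OF r] by simp
  have pos: "num_le T (i - 1) r < num_le T i r"
    using lowers_in_row_count[OF r] num_eq_diff(1)[OF i, of T r] by simp
  have "row_excess i T r \<le> m"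
    using inv K num_le_bound[of i r] unfolding scan_invariant_def by metis
  then have "?K 0 < m" using lowers_in_row_peak(2)[OF r, of 0] pos by simp
  then have "cs \<noteq> []" using inv by (auto simp: scan_invariant_def)
  then obtain p d where p: "hd cs = (p, d)" and d: "d < lam p" "?K (Suc d) = m" "\<And>d'. d' \<le> d \<Longrightarrow> ?K d' < m"
    and entry: "T p ! d = i"
    using inv hd_in_set[of cs] SSYT_rowD(1)[OF T]
    by (cases "hd cs") (auto simp: scan_invariant_def ends_first_max_def entry_def)
  have m: "m = row_excess i T r"
    using d(2) lowers_in_row_peak(1)[OF r, of "Suc d"] \<open>row_excess i T r \<le> m\<close> by simp
  have "\<not> Suc d < num_le T i r" using lowers_in_row_peak(2)[OF r, of "Suc d"] d(2) m by auto
  moreover have "\<not> num_le T i r \<le> d" using d(3)[of "num_le T i r"] K m by auto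
  ultimately have Suc_d: "num_le T i r = Suc d" by simp
  have r_d: "d < lam r \<and> T r ! d = i" using nth_eq_iff[OF T i, of d r] Suc_d pos by simp
  then have "p = r" using column_entry_unique[OF lam T, of d p r] d(1) entry by simp
  have "sorted ((T r)[d := Suc i])"
    unfolding sorted_iff_nth_mono_less
  proof (intro allI impI)
    fix j k assume jk: "j < k" "k < length ((T r)[d := Suc i])"
    then have k: "k < lam r" by (simp add: SSYT_rowD(1)[OF T])
    have "T r ! j \<le> T r ! k"
      using jk SSYT_rowD(3)[OF T, of r] by (simp add: sorted_iff_nth_mono)
    moreover have "Suc i \<le> T r ! k" if "d < k"
      using that nth_le_iff[OF T, of k i r] Suc_d k by simp
    moreover have "T r ! j \<le> i" if "j < d"
      using that nth_le_iff[OF T, of j i r] Suc_d by simp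
    ultimately show "(T r)[d := Suc i] ! j \<le> (T r)[d := Suc i] ! k"
      using jk r_d by (auto simp: nth_list_update SSYT_rowD(1)[OF T])
  qed
  then have "set_entry T (hd cs) (Suc i) = switch r i (Suc i) T"
    unfolding p \<open>p = r\<close> using r_d by (intro set_entry_eq_switch) (simp_all add: SSYT_rowD(1)[OF T])
  then show ?thesis
    using \<open>cs \<noteq> []\<close> by (simp add: f_op_def cs last_rev)
qed

text \<open>Dually, the step out of the last maximum is across the first entry \<open>i + 1\<close> of row \<open>r\<close>.\<close>

lemma e_op_Some:
  assumes r: "raises_in_row i T r"
  shows "e_op n i T = Some (switch r (Suc i) i T)"
proof -
  let ?K = "column_excess n i T"
  obtain m os cs where os: "filter (\<lambda>p. entry T p = Suc i) (unmatched_cells n i T) = rev os"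
    and inv: "scan_invariant ?K i T (lam 0) m os cs"
    by (rule unmatched_cells_scan)
  have K: "?K (num_le T i r) = row_excess i T r"
    using column_excess_num_le[OF lam T i] raises_in_row_bound[OF r] by simp
  have pos: "num_le T i r < num_le T (Suc i) r"
    using raises_in_row_count(1)[OF r] num_eq_diff(2)[OF i, of T r] by linarith
  have "row_excess i T r \<le> m"
    using inv K num_le_bound[of i r] unfolding scan_invariant_def by metis
  moreover have "num_le T i r < lam 0" using pos num_le_bound[of "Suc i" r] by simp
  ultimately have "?K (lam 0) < m" using raises_in_row_peak(2)[OF r, of "lam 0"] by simp
  then have "os \<noteq> []" using inv by (auto simp: scan_invariant_def)
  then obtain p d where p: "last os = (p, d)" and d: "d < lam p" "?K d = m"
      "\<And>d'. d < d' \<Longrightarrow> d' \<le> lam 0 \<Longrightarrow> ?K d' < m"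
    and entry: "T p ! d = Suc i"
    using inv last_in_set[of os] SSYT_rowD(1)[OF T]
    by (cases "last os") (auto simp: scan_invariant_def starts_last_max_def entry_def)
  have m: "m = row_excess i T r"
    using d(2) raises_in_row_peak(1)[OF r, of d] \<open>row_excess i T r \<le> m\<close> by simp
  have "\<not> num_le T i r < d" using raises_in_row_peak(2)[OF r, of d] d(2) m by auto
  moreover have "\<not> d < num_le T i r" using d(3)[of "num_le T i r"] K m num_le_bound[of i r] by auto
  ultimately have eq_d: "num_le T i r = d" by simp
  have r_d: "d < lam r \<and> T r ! d = Suc i" using nth_eq_iff[OF T, of "Suc i" d r] eq_d pos by simp
  then have "p = r" using column_entry_unique[OF lam T, of d p r] d(1) entry by simp
  have "sorted ((T r)[d := i])"
    unfolding sorted_iff_nth_mono_less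
  proof (intro allI impI)
    fix j k assume jk: "j < k" "k < length ((T r)[d := i])"
    have "T r ! j \<le> T r ! k"
      using jk SSYT_rowD(3)[OF T, of r] by (simp add: sorted_iff_nth_mono)
    moreover have "T r ! j \<le> i" if "j < d"
      using that nth_le_iff[OF T, of j i r] eq_d by simp
    ultimately show "(T r)[d := i] ! j \<le> (T r)[d := i] ! k"
      using jk r_d by (auto simp: nth_list_update SSYT_rowD(1)[OF T])
  qed
  then have "set_entry T (last os) i = switch r (Suc i) i T"
    unfolding p \<open>p = r\<close> using r_d by (intro set_entry_eq_switch) (simp_all add: SSYT_rowD(1)[OF T])
  then show ?thesis
    using \<open>os \<noteq> []\<close> by (simp add: e_op_def os hd_rev)
qed

lemma no_lowering_row:
  assumes "\<And>r. \<not> lowers_in_row i T r"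
  shows "row_excess i T r \<le> row_excess i T n"
  using exists_last_max[of n "row_excess i T" r] row_excess_beyond assms
  unfolding lowers_in_row_def by (metis not_less)

lemma no_raising_row:
  assumes "\<And>r. \<not> raises_in_row i T r"
  shows "row_excess i T r \<le> 0"
  using exists_first_max[of n "row_excess i T"] row_excess_beyond assms
  unfolding raises_in_row_def by (metis not_less order_trans)

lemma f_op_None:
  assumes "\<And>r. \<not> lowers_in_row i T r"
  shows "f_op n i T = None"
proof -
  let ?K = "column_excess n i T"
  obtain m os cs where cs: "filter (\<lambda>p. entry T p = i) (unmatched_cells n i T) = rev cs"
    and inv: "scan_invariant ?K i T (lam 0) m os cs"
    by (rule unmatched_cells_scan)
  have "?K c \<le> ?K 0" for c
    using column_excess_le_row_excess[of c] no_lowering_row[OF assms]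
      column_excess_num_le[OF lam T i, of n] num_le_beyond[OF lam T, of n i]
    by (metis order_refl order_trans)
  then have "cs = []"
    using inv unfolding scan_invariant_def ends_first_max_def by (metis le0 not_less)
  then show ?thesis by (simp add: f_op_def cs)
qed

lemma e_op_None:
  assumes "\<And>r. \<not> raises_in_row i T r"
  shows "e_op n i T = None"
proof -
  let ?K = "column_excess n i T"
  obtain m os cs where os: "filter (\<lambda>p. entry T p = Suc i) (unmatched_cells n i T) = rev os"
    and inv: "scan_invariant ?K i T (lam 0) m os cs"
    by (rule unmatched_cells_scan)
  have "num_le T v s - lam 0 = 0" for v s using num_le_bound[of v s] by simp
  then have "?K (lam 0) = 0" by (simp add: column_excess_def)
  then have "?K c \<le> ?K (lam 0)" for c
    using column_excess_le_row_excess[of c] no_raising_row[OF assms] by (metis order_trans)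
  moreover have "?K (snd (last os)) = m" "?K (lam 0) < m" if "os \<noteq> []"
    using inv that by (cases os, simp_all add: scan_invariant_def starts_last_max_def)+
  ultimately have "os = []" by (metis not_less)
  then show ?thesis by (simp add: e_op_def os)
qed

end

section \<open>Changing a letter of a row\<close>

lemma mset_switch:
  assumes "x \<in> set (T r)"
  shows "mset (switch r x y T s) = (if s = r then add_mset y (mset (T r) - {#x#}) else mset (T s))"
  using assms by (simp add: switch_def)

lemma star_switch:
  assumes "x \<in> set (S r)"
  shows "switch r x y S \<star> T = switch r x y (S \<star> T)"
proof
  fix s
  have x: "x \<in> set ((S \<star> T) r)" using assms by (simp add: star_def)
  have "mset ((switch r x y S \<star> T) s) = mset (switch r x y (S \<star> T) s)"
    unfolding mset_star mset_switch[of x S r, OF assms] mset_switch[of x "S \<star> T" r, OF x]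
    using assms by (simp add: multiset_eq_iff)
  moreover have "sorted ((switch r x y S \<star> T) s)" "sorted (switch r x y (S \<star> T) s)"
    by (simp_all add: star_def switch_def sorted_insort)
  ultimately show "(switch r x y S \<star> T) s = switch r x y (S \<star> T) s"
    by (rule sorted_eq_if_mset_eq[rotated 2])
qed

lemma switch_switch:
  assumes "x \<in> set (T r)" "sorted (T r)"
  shows "switch r y x (switch r x y T) = T"
proof
  fix s
  have y: "y \<in> set (switch r x y T r)" by (simp add: switch_def set_insort_key)
  show "switch r y x (switch r x y T) s = T s"
  proof (cases "s = r")
    case True
    have "mset (switch r y x (switch r x y T) r) = mset (T r)"
      unfolding mset_switch[of y "switch r x y T" r, OF y] mset_switch[of x T r, OF assms(1)]
      using assms(1) by simp
    moreover have "sorted (switch r y x (switch r x y T) r)" by (simp add: switch_def sorted_insort)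
    ultimately show ?thesis using sorted_eq_if_mset_eq assms(2) True by blast
  qed (simp add: switch_def)
qed

text \<open>For \<open>h x = x\<close> this decreases under raising operators, for \<open>h x = n - x\<close> under lowering operators.
  So repeated raising, and repeated lowering, stops.\<close>

definition entry_weight :: "(nat \<Rightarrow> nat) \<Rightarrow> nat \<Rightarrow> tableau \<Rightarrow> nat" where
  "entry_weight h n T = (\<Sum>r<n. \<Sum>x\<in>#mset (T r). h x)"

lemma entry_weight_switch:
  assumes "x \<in> set (T r)" "r < n" "h y < h x"
  shows "entry_weight h n (switch r x y T) < entry_weight h n T"
  unfolding entry_weight_def
proof (rule sum_strict_mono_ex1)
  have eq: "(\<Sum>z\<in>#mset (T r). h z) = h x + (\<Sum>z\<in>#mset (T r) - {#x#}. h z)"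
    using assms(1) by (metis image_mset_add_mset insert_DiffM set_mset_mset sum_mset.insert)
  show "\<forall>s\<in>{..<n}. (\<Sum>z\<in>#mset (switch r x y T s). h z) \<le> (\<Sum>z\<in>#mset (T s). h z)"
    using eq assms(3) by (simp add: mset_switch[of x T r, OF assms(1)])
  show "\<exists>s\<in>{..<n}. (\<Sum>z\<in>#mset (switch r x y T s). h z) < (\<Sum>z\<in>#mset (T s). h z)"
    using eq assms(2,3) by (intro bexI[of _ r]) (simp_all add: mset_switch[of x T r, OF assms(1)])
qed simp

text \<open>The switch adds an \<open>i + 1\<close> to row \<open>r\<close>, which counts from row \<open>r\<close> on, and removes an \<open>i\<close>, which counts
  from row \<open>r + 1\<close> on. This turns a last maximum into a first maximum, and \<open>e\<^sub>i\<close> inverts \<open>f\<^sub>i\<close>.\<close>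

lemma row_excess_switch_down:
  assumes "i \<in> set (T r)"
  shows "row_excess i (switch r i (Suc i) T) s
    = row_excess i T s + (if s < r then 0 else if s = r then 1 else 2)"
proof -
  have "0 < num_eq T i r" using assms by simp
  then have a: "int (num_eq (switch r i (Suc i) T) i s) = int (num_eq T i s) - of_bool (s = r)" for s
    using assms by (auto simp: mset_switch of_nat_diff)
  have b: "int (num_eq (switch r i (Suc i) T) (Suc i) s) = int (num_eq T (Suc i) s) + of_bool (s = r)" for s
    using assms by (auto simp: mset_switch)
  show ?thesis by (induction s) (auto simp: row_excess_0 row_excess_Suc a b)
qed

lemma row_excess_switch_up:
  assumes "Suc i \<in> set (T r)"
  shows "row_excess i (switch r (Suc i) i T) s
    = row_excess i T s - (if s < r then 0 else if s = r then 1 else 2)"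
proof -
  have "0 < num_eq T (Suc i) r" using assms by simp
  then have b: "int (num_eq (switch r (Suc i) i T) (Suc i) s) = int (num_eq T (Suc i) s) - of_bool (s = r)" for s
    using assms by (auto simp: mset_switch of_nat_diff)
  have a: "int (num_eq (switch r (Suc i) i T) i s) = int (num_eq T i s) + of_bool (s = r)" for s
    using assms by (auto simp: mset_switch)
  show ?thesis by (induction s) (auto simp: row_excess_0 row_excess_Suc a b)
qed

lemma raises_after_lowering:
  assumes r: "lowers_in_row i T r"
  shows "raises_in_row i (switch r i (Suc i) T) r"
proof -
  note excess = row_excess_switch_down[of i T r, OF lowers_in_row_mem[OF r]]
  have "0 \<le> row_excess i T 0" by (simp add: row_excess_0)
  also have "row_excess i T 0 \<le> row_excess i T r" using r by (simp add: lowers_in_row_def)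
  finally have "0 \<le> row_excess i T r" .
  moreover have "row_excess i (switch r i (Suc i) T) s \<le> row_excess i (switch r i (Suc i) T) r"
      "s < r \<Longrightarrow> row_excess i (switch r i (Suc i) T) s < row_excess i (switch r i (Suc i) T) r" for s
  proof -
    have le: "row_excess i T s \<le> row_excess i T r" using r by (simp add: lowers_in_row_def)
    have less: "row_excess i T s < row_excess i T r" if "r < s"
      using r that by (simp add: lowers_in_row_def)
    show "row_excess i (switch r i (Suc i) T) s \<le> row_excess i (switch r i (Suc i) T) r"
      unfolding excess using le less by (cases s r rule: linorder_cases) simp_all
    show "row_excess i (switch r i (Suc i) T) s < row_excess i (switch r i (Suc i) T) r" if "s < r"
      unfolding excess using le that by simp
  qed
  ultimately show ?thesis
    unfolding raises_in_row_def by (simp add: excess)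
qed

lemma lowers_after_raising:
  assumes r: "raises_in_row i T r"
  shows "lowers_in_row i (switch r (Suc i) i T) r"
proof -
  note excess = row_excess_switch_up[of i T r, OF raises_in_row_mem[OF r]]
  have "row_excess i (switch r (Suc i) i T) s \<le> row_excess i (switch r (Suc i) i T) r"
      "r < s \<Longrightarrow> row_excess i (switch r (Suc i) i T) s < row_excess i (switch r (Suc i) i T) r" for s
  proof -
    have le: "row_excess i T s \<le> row_excess i T r" using r by (simp add: raises_in_row_def)
    have less: "row_excess i T s < row_excess i T r" if "s < r"
      using r that by (simp add: raises_in_row_def)
    show "row_excess i (switch r (Suc i) i T) s \<le> row_excess i (switch r (Suc i) i T) r"
      unfolding excess using le less by (cases s r rule: linorder_cases) simp_all
    show "row_excess i (switch r (Suc i) i T) s < row_excess i (switch r (Suc i) i T) r" if "r < s"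
      unfolding excess using le that by simp
  qed
  then show ?thesis
    unfolding lowers_in_row_def by blast
qed

lemma num_le_switch_down:
  assumes "i \<in> set (T r)"
  shows "num_le (switch r i (Suc i) T) v s = num_le T v s - of_bool (s = r \<and> v = i)"
proof -
  obtain M where "mset (T r) = add_mset i M" using assms by (metis multi_member_split set_mset_mset)
  then show ?thesis using assms by (auto simp: num_le_mset mset_switch)
qed

lemma num_le_switch_up:
  assumes "Suc i \<in> set (T r)"
  shows "num_le (switch r (Suc i) i T) v s = num_le T v s + of_bool (s = r \<and> v = i)"
proof -
  obtain M where "mset (T r) = add_mset (Suc i) M"
    using assms by (metis multi_member_split set_mset_mset)
  then show ?thesis using assms by (auto simp: num_le_mset mset_switch)
qed

lemma switch_in_SSYT:
  assumes lam: "partition_le n lam" and T: "T \<in> SSYT n lam"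
    and x: "x \<in> set (T r)" and y: "y \<in> {1..n}"
    and interlacing: "\<And>v s. num_le (switch r x y T) (Suc v) (Suc s) \<le> num_le (switch r x y T) v s"
  shows "switch r x y T \<in> SSYT n lam"
proof -
  have "length (switch r x y T s) = lam s" for s
  proof -
    have "0 < length (T r)" using x by auto
    then show ?thesis using x SSYT_rowD(1)[OF T] by (auto simp: switch_def length_remove1)
  qed
  moreover have "set (switch r x y T s) \<subseteq> {1..n}" for s
    using SSYT_rowD(2)[OF T, of s] y set_remove1_subset[of x "T r"] by (auto simp: switch_def set_insort_key)
  moreover have "sorted (switch r x y T s)" for s
    using SSYT_rowD(3)[OF T, of s] by (simp add: switch_def sorted_insort)
  ultimately show ?thesis using interlacing by (simp add: SSYT_iff_interlacing[OF lam])
qed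

context
  fixes n i :: nat and lam :: "nat \<Rightarrow> nat" and T :: tableau
  assumes lam: "partition_le n lam" and T: "T \<in> SSYT n lam" and i: "1 \<le> i" "i < n"
begin

text \<open>Only the number of entries at most \<open>i\<close> of row \<open>r\<close> drops, so the only interlacing condition at risk
  is the one with row \<open>r + 1\<close>. It was strict before: the excess falls after row \<open>r\<close>, so row \<open>r\<close> has more
  entries \<open>i\<close> than row \<open>r + 1\<close> has entries \<open>i + 1\<close>. The case of raising is symmetric.\<close>

lemma lowered_in_SSYT:
  assumes r: "lowers_in_row i T r"
  shows "switch r i (Suc i) T \<in> SSYT n lam"
proof (rule switch_in_SSYT[OF lam T])
  show mem: "i \<in> set (T r)" using r by (rule lowers_in_row_mem)
  show "Suc i \<in> {1..n}" using i by simp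
  have "num_le T (Suc i) (Suc r) < num_le T i r"
    using lowers_in_row_count[OF r] num_le_Suc[of T i "Suc r"]
      num_le_Suc[of T "i - 1" r] num_le_interlaced[OF lam T, of "i - 1" r] i by simp
  then show "num_le (switch r i (Suc i) T) (Suc v) (Suc s) \<le> num_le (switch r i (Suc i) T) v s" for v s
    using num_le_interlaced[OF lam T, of v s] by (auto simp: num_le_switch_down[of i T r, OF mem])
qed

lemma raised_in_SSYT:
  assumes r: "raises_in_row i T r"
  shows "switch r (Suc i) i T \<in> SSYT n lam"
proof (rule switch_in_SSYT[OF lam T])
  show mem: "Suc i \<in> set (T r)" using r by (rule raises_in_row_mem)
  show "i \<in> {1..n}" using i by simp
  have "num_le T i (Suc q) < num_le T (i - 1) q" if "r = Suc q" for q
    using raises_in_row_count(2)[OF r] num_le_Suc[of T i r]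
      num_le_Suc[of T "i - 1" q] num_le_interlaced[OF lam T, of i q] i that by simp
  then show "num_le (switch r (Suc i) i T) (Suc v) (Suc s) \<le> num_le (switch r (Suc i) i T) v s" for v s
    using num_le_interlaced[OF lam T, of v s] by (auto simp: num_le_switch_up[of i T r, OF mem])
qed

lemma f_op_iff: "f_op n i T = Some T' \<longleftrightarrow> (\<exists>r. lowers_in_row i T r \<and> T' = switch r i (Suc i) T)"
  using f_op_Some[OF lam T i(1)] f_op_None[OF lam T i(1)] by (metis option.distinct(1) option.inject)

lemma e_op_iff: "e_op n i T = Some T' \<longleftrightarrow> (\<exists>r. raises_in_row i T r \<and> T' = switch r (Suc i) i T)"
  using e_op_Some[OF lam T i(1)] e_op_None[OF lam T i(1)] by (metis option.distinct(1) option.inject)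

end

lemma f_op_step:
  assumes lam: "partition_le n lam" and T: "T \<in> SSYT n lam" and i: "1 \<le> i" "i < n"
    and f: "f_op n i T = Some T'"
  shows "T' \<in> SSYT n lam" "e_op n i T' = Some T"
    "entry_weight (\<lambda>x. n - x) n T' < entry_weight (\<lambda>x. n - x) n T"
proof -
  obtain r where r: "lowers_in_row i T r" and T': "T' = switch r i (Suc i) T"
    using f f_op_iff[OF lam T i] by blast
  show in_SSYT: "T' \<in> SSYT n lam" unfolding T' by (rule lowered_in_SSYT[OF lam T i r])
  have mem: "i \<in> set (T r)" using r by (rule lowers_in_row_mem)
  have "switch r (Suc i) i T' = T"
    unfolding T' using switch_switch[of i T r "Suc i"] mem SSYT_rowD(3)[OF T] by simp
  then show "e_op n i T' = Some T"
    using e_op_iff[OF lam in_SSYT i] raises_after_lowering[OF r] T' by metis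
  show "entry_weight (\<lambda>x. n - x) n T' < entry_weight (\<lambda>x. n - x) n T"
    unfolding T' using mem lowers_in_row_bound[OF lam T i(1) r] i by (intro entry_weight_switch) auto
qed

lemma e_op_step:
  assumes lam: "partition_le n lam" and T: "T \<in> SSYT n lam" and i: "1 \<le> i" "i < n"
    and e: "e_op n i T = Some T'"
  shows "T' \<in> SSYT n lam" "f_op n i T' = Some T"
    "entry_weight id n T' < entry_weight id n T"
proof -
  obtain r where r: "raises_in_row i T r" and T': "T' = switch r (Suc i) i T"
    using e e_op_iff[OF lam T i] by blast
  show in_SSYT: "T' \<in> SSYT n lam" unfolding T' by (rule raised_in_SSYT[OF lam T i r])
  have mem: "Suc i \<in> set (T r)" using r by (rule raises_in_row_mem)
  have "switch r i (Suc i) T' = T"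
    unfolding T' using switch_switch[of "Suc i" T r i] mem SSYT_rowD(3)[OF T] by simp
  then show "f_op n i T' = Some T"
    using f_op_iff[OF lam in_SSYT i] lowers_after_raising[OF r] T' by metis
  show "entry_weight id n T' < entry_weight id n T"
    unfolding T' using mem raises_in_row_bound[OF lam T i(1) r] by (intro entry_weight_switch) auto
qed

section \<open>Highest and lowest weight vectors\<close>

definition row_constant :: "(nat \<Rightarrow> nat) \<Rightarrow> tableau" where
  "row_constant lam = (\<lambda>r. replicate (lam r) (Suc r))"

lemma row_constant_in_SSYT:
  assumes lam: "partition_le n lam"
  shows "row_constant lam \<in> SSYT n lam"
proof -
  have num_le: "num_le (row_constant lam) v r = (if r < v then lam r else 0)" for v r
    by (simp add: num_le_def row_constant_def)
  have "lam (Suc r) \<le> lam r" for r using lam by (simp add: partition_le_def antimono_def)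
  moreover have "set (row_constant lam r) \<subseteq> {1..n}" for r
  proof (cases "n \<le> r")
    case True
    then have "lam r = 0" using lam by (simp add: partition_le_def)
    then show ?thesis by (simp add: row_constant_def)
  qed (auto simp: row_constant_def)
  ultimately show ?thesis
    unfolding SSYT_iff_interlacing[OF lam] num_le by (simp add: row_constant_def)
qed

text \<open>By induction on the rows: if the rows before row \<open>r\<close> are as claimed, they contain no \<open>i\<close> and no
  \<open>i + 1\<close> for \<open>i > r\<close>, so the excess of row \<open>r\<close> is its number of entries \<open>i + 1\<close>. A tableau that
  \<open>e\<^sub>i\<close> kills has no positive excess.\<close>

lemma unraisable_row_constant:
  assumes lam: "partition_le n lam" and T: "T \<in> SSYT n lam"
    and none: "\<And>i. 1 \<le> i \<Longrightarrow> i < n \<Longrightarrow> e_op n i T = None"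
  shows "T = row_constant lam"
proof
  fix r
  have "num_eq T v r = 0" if "v \<noteq> Suc r" for v
    using that
  proof (induction r arbitrary: v rule: less_induct)
    case (less r)
    consider "v \<le> r" | "v > n" | i where "v = Suc i" "r < i" "i < n"
      using less.prems by (cases v) force+
    then show ?case
    proof cases
      case 1
      then have "num_le T v r = 0" by (rule num_le_below_diagonal[OF lam T])
      then show ?thesis by (auto simp: num_le_def filter_empty_conv count_mset_0_iff)
    next
      case 2
      then have "v \<notin> set (T r)" using SSYT_rowD(2)[OF T, of r] by auto
      then show ?thesis by (metis count_mset_0_iff)
    next
      case 3
      have zero: "num_eq T i s = 0" "num_eq T (Suc i) s = 0" if "s < r" for s
        using less.IH[OF that] that 3(2) by simp_all
      have "(\<Sum>s<r. int (num_eq T (Suc i) s) - int (num_eq T i s)) = 0"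
        by (rule sum.neutral) (metis lessThan_iff zero diff_self)
      then have "row_excess i T r = int (num_eq T v r)"
        by (simp only: row_excess_def 3(1))
      moreover have "row_excess i T r \<le> 0"
      proof (rule no_raising_row[OF lam T])
        show "\<not> raises_in_row i T r" for r
          using none[of i] e_op_Some[OF lam T] 3 by fastforce
      qed (use 3 in simp)
      ultimately show ?thesis by simp
    qed
  qed
  then have "x = Suc r" if "x \<in> set (T r)" for x
    using that by (metis count_mset_0_iff)
  then show "T r = row_constant lam r"
    unfolding row_constant_def SSYT_rowD(1)[OF T, symmetric] by (metis replicate_length_same)
qed

text \<open>The inequality \<open>num_le T (Suc v) (Suc s) \<le> num_le T v s\<close> is an equality for all \<open>v < n\<close>, by
  induction on \<open>v\<close>. In the step for \<open>i = v\<close>, the hypothesis turns the difference of the excesses far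
  below the tableau and in row 0 into a sum of the nonpositive numbers
  \<open>num_le T (Suc i) (Suc s) - num_le T i s\<close>, while this difference is nonnegative for a tableau that
  \<open>f\<^sub>i\<close> kills. Iterating the equality reaches \<open>v = n\<close>, where all entries of the row are counted.\<close>

lemma unlowerable_num_le:
  assumes lam: "partition_le n lam" and T: "T \<in> SSYT n lam"
    and none: "\<And>i. 1 \<le> i \<Longrightarrow> i < n \<Longrightarrow> f_op n i T = None"
    and v: "v \<le> n"
  shows "num_le T v r = lam (n + r - v)"
proof -
  have step: "num_le T (Suc v) (Suc s) = num_le T v s" if "v < n" for v s
    using that
  proof (induction v arbitrary: s)
    case 0
    then show ?case using num_le_below_diagonal[OF lam T, of 1 "Suc s"] num_le_zero[OF T] by simp
  next
    case (Suc v)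
    note IH = Suc.IH and Suc_v = Suc.prems
    define i where "i = Suc v"
    have i: "1 \<le> i" "i < n" "i - 1 = v" using Suc.prems by (simp_all add: i_def)
    have "row_excess i T 0 \<le> row_excess i T n"
    proof (rule no_lowering_row[OF lam T i(1)])
      show "\<not> lowers_in_row i T r" for r
        using none[OF i(1,2)] f_op_Some[OF lam T i(1)] by fastforce
    qed
    moreover have excess: "row_excess i T m
        = row_excess i T 0 + (\<Sum>s<m. int (num_le T (Suc i) (Suc s)) - int (num_le T i s))" for m
    proof (induction m)
      case (Suc m)
      have "num_le T i (Suc m) = num_le T (i - 1) m"
        unfolding i(3) unfolding i_def using IH Suc_v by simp
      then show ?case using Suc num_eq_diff[OF i(1), of T] by (simp add: row_excess_Suc)
    qed simp
    ultimately have ge: "0 \<le> (\<Sum>s<n. int (num_le T (Suc i) (Suc s)) - int (num_le T i s))"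
      using excess[of n] by linarith
    have le: "int (num_le T (Suc i) (Suc s)) - int (num_le T i s) \<le> 0" for s
      using num_le_interlaced[OF lam T, of i s] by simp
    show ?case
    proof (cases "s < n")
      case True
      have "(\<Sum>s<n. int (num_le T i s) - int (num_le T (Suc i) (Suc s))) = 0"
        using ge sum_nonneg[of "{..<n}" "\<lambda>s. int (num_le T i s) - int (num_le T (Suc i) (Suc s))"] le
        by (simp add: sum_subtractf)
      then have "int (num_le T i s) - int (num_le T (Suc i) (Suc s)) = 0"
        using True le by (subst (asm) sum_nonneg_eq_0_iff) auto
      then show ?thesis by (simp add: i_def)
    next
      case False
      then show ?thesis using num_le_beyond[OF lam T] by simp
    qed
  qed
  have "num_le T (n - k) r = lam (r + k)" if "k \<le> n" for k
    using that
  proof (induction k arbitrary: r)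
    case 0
    then show ?case using num_le_top[OF T, of n r] by simp
  next
    case (Suc k)
    then have "num_le T (n - Suc k) r = num_le T (n - k) (Suc r)"
      using step[of "n - Suc k" r] by (simp add: Suc_diff_Suc)
    then show ?case using Suc by simp
  qed
  from this[of "n - v"] v show ?thesis by (simp add: add.commute)
qed

section \<open>Adding an extremal tableau\<close>

lemma row_excess_star: "row_excess i (S \<star> T) r = row_excess i S r + row_excess i T r"
  by (induction r) (simp_all add: row_excess_0 row_excess_Suc)

lemma row_excess_row_constant:
  assumes "1 \<le> i"
  shows "row_excess i (row_constant mu) r = (if r < i then 0 else int (mu i) - int (mu (i - 1)))"
proof -
  have count: "num_eq (row_constant mu) v r = (if v = Suc r then mu r else 0)" for v r
    by (simp add: row_constant_def)
  show ?thesis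
    using assms by (induction r) (auto simp: row_excess_0 row_excess_Suc count)
qed

context
  fixes n i :: nat and lam :: "nat \<Rightarrow> nat" and S :: tableau
  assumes lam: "partition_le n lam" and S: "S \<in> SSYT n lam" and i: "1 \<le> i"
begin

text \<open>The entries of row \<open>s\<close> are at least \<open>s + 1\<close>.\<close>

lemma row_excess_low_rows:
  assumes "i \<le> r"
  shows "row_excess i S r = row_excess i S i"
proof (rule row_excess_const[OF _ _ assms])
  have "num_eq S v s = 0" if "v \<le> s" for v s
    using num_le_below_diagonal[OF lam S that]
    by (auto simp: num_le_def filter_empty_conv count_mset_0_iff)
  then show "num_eq S i s = 0" if "i \<le> s" for s using that by (metis count_mset_0_iff)
  show "num_eq S (Suc i) s = 0" if "i < s" for s
    using that \<open>\<And>v s. v \<le> s \<Longrightarrow> num_eq S v s = 0\<close> by (metis Suc_leI)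
qed

text \<open>The cell above an entry \<open>i + 1\<close> of row \<open>i\<close> can only contain \<open>i\<close>.\<close>

lemma row_excess_last_step: "row_excess i S i \<le> row_excess i S (i - 1)"
proof -
  obtain k where k: "i = Suc k" using i by (cases i) auto
  have "num_eq S (Suc i) i = num_le S (Suc i) i"
    using num_le_Suc[of S i i] num_le_below_diagonal[OF lam S, of i i] by simp
  also have "\<dots> \<le> num_le S i (i - 1)"
    using num_le_interlaced[OF lam S, of i "i - 1"] i by simp
  also have "\<dots> = num_eq S i (i - 1)"
    using num_le_Suc[of S k k] num_le_below_diagonal[OF lam S, of k k] k by simp
  finally show ?thesis unfolding k using row_excess_Suc[of i S k] k by simp
qed

context
  fixes mu :: "nat \<Rightarrow> nat"
  assumes mu: "partition_le n mu"
begin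

lemma row_excess_star_row_constant:
  obtains k where "0 \<le> k"
    "\<And>r. row_excess i (S \<star> row_constant mu) r = row_excess i S r - (if r < i then 0 else k)"
proof
  show "0 \<le> int (mu (i - 1)) - int (mu i)"
    using mu by (simp add: partition_le_def antimono_def)
  show "row_excess i (S \<star> row_constant mu) r
      = row_excess i S r - (if r < i then 0 else int (mu (i - 1)) - int (mu i))" for r
    by (simp add: row_excess_star row_excess_row_constant[OF i])
qed

lemma lowers_star_row_constant:
  assumes r: "lowers_in_row i S r"
  shows "lowers_in_row i (S \<star> row_constant mu) r"
proof -
  obtain k where k: "0 \<le> k" and
    g: "\<And>r. row_excess i (S \<star> row_constant mu) r = row_excess i S r - (if r < i then 0 else k)"
    using row_excess_star_row_constant by blast
  have "row_excess i S (Suc r) < row_excess i S r" using r by (simp add: lowers_in_row_def)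
  then have "r < i" using row_excess_low_rows[of r] row_excess_low_rows[of "Suc r"] by fastforce
  then have "row_excess i (S \<star> row_constant mu) r = row_excess i S r" by (simp add: g)
  moreover have "row_excess i (S \<star> row_constant mu) s \<le> row_excess i S s" for s
    using k by (simp add: g)
  ultimately show ?thesis
    using r unfolding lowers_in_row_def by (metis order_trans order_le_less_trans)
qed

text \<open>The first maximum lies before row \<open>i\<close> on both sides, because the excess of row \<open>i - 1\<close> is at least that
  of every later row. In the rows before \<open>i\<close> both excesses agree.\<close>

lemma raises_star_row_constant_iff:
  "raises_in_row i (S \<star> row_constant mu) r \<longleftrightarrow> raises_in_row i S r"
proof -
  obtain k where k: "0 \<le> k" and
    g: "\<And>r. row_excess i (S \<star> row_constant mu) r = row_excess i S r - (if r < i then 0 else k)"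
    using row_excess_star_row_constant by blast
  have low: "row_excess i S s \<le> row_excess i S (i - 1)" if "i \<le> s" for s
    using row_excess_low_rows[OF that] row_excess_last_step by simp
  show ?thesis
  proof (cases "r < i")
    case True
    have "row_excess i (S \<star> row_constant mu) s \<le> row_excess i S r
        \<longleftrightarrow> row_excess i S s \<le> row_excess i S r"
      if "row_excess i S (i - 1) \<le> row_excess i S r" for s
      using low[of s] k that by (cases "s < i") (simp_all add: g)
    moreover have "row_excess i (S \<star> row_constant mu) (i - 1) = row_excess i S (i - 1)"
      using i by (simp add: g)
    moreover have "row_excess i (S \<star> row_constant mu) s = row_excess i S s" if "s \<le> r" for s
      using that True by (simp add: g)
    ultimately show ?thesis
      unfolding raises_in_row_def by (metis less_imp_le order_refl)
  next
    case False
    then have "i - 1 < r" "row_excess i S r \<le> row_excess i S (i - 1)" using i low by auto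
    moreover from this have
      "row_excess i (S \<star> row_constant mu) r \<le> row_excess i (S \<star> row_constant mu) (i - 1)"
      using False k i by (simp add: g)
    ultimately show ?thesis unfolding raises_in_row_def by (meson not_less)
  qed
qed

end

end

text \<open>Row \<open>r + 1\<close> of the lowest weight vector has as many entries \<open>i + 1\<close> as row \<open>r\<close> has entries \<open>i\<close>,
  namely one for each column of height \<open>n + r + 1 - i\<close>.\<close>

lemma row_excess_lowest:
  assumes Z: "\<And>v r. v \<le> n \<Longrightarrow> num_le Z v r = mu (n + r - v)" and i: "1 \<le> i" "i < n"
  shows "row_excess i Z r = row_excess i Z 0"
proof (induction r)
  case (Suc r)
  have "int (num_eq Z (Suc i) (Suc r)) = int (num_eq Z i r)"
    unfolding num_eq_diff[OF i(1)] using i by (simp add: Z Suc_diff_le)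
  then show ?case using Suc by (simp add: row_excess_Suc)
qed simp

lemma lowers_star_lowest_iff:
  assumes "\<And>v r. v \<le> n \<Longrightarrow> num_le Z v r = mu (n + r - v)" "1 \<le> i" "i < n"
  shows "lowers_in_row i (S \<star> Z) r \<longleftrightarrow> lowers_in_row i S r"
  using row_excess_lowest[OF assms] unfolding lowers_in_row_def row_excess_star by (metis add_le_cancel_right add_less_cancel_right)

lemma raises_star_lowest:
  assumes "\<And>v r. v \<le> n \<Longrightarrow> num_le Z v r = mu (n + r - v)" "1 \<le> i" "i < n"
    and "raises_in_row i S r"
  shows "raises_in_row i (S \<star> Z) r"
proof -
  have "row_excess i (S \<star> Z) s = row_excess i S s + row_excess i Z 0" for s
    using row_excess_lowest[OF assms(1-3)] by (simp add: row_excess_star)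
  moreover have "0 \<le> row_excess i Z 0" by (simp add: row_excess_0)
  ultimately show ?thesis using assms(4) by (simp add: raises_in_row_def)
qed

context
  fixes n i :: nat and lam mu :: "nat \<Rightarrow> nat" and S T :: tableau
  assumes lam: "partition_le n lam" and mu: "partition_le n mu"
    and S: "S \<in> SSYT n lam" and T: "T \<in> SSYT n mu" and i: "1 \<le> i" "i < n"
begin

lemma f_op_star:
  assumes "\<And>r. lowers_in_row i S r \<Longrightarrow> lowers_in_row i (S \<star> T) r" and "f_op n i S = Some S'"
  shows "f_op n i (S \<star> T) = Some (S' \<star> T)"
proof -
  obtain r where r: "lowers_in_row i S r" and S': "S' = switch r i (Suc i) S"
    using assms(2) f_op_iff[OF lam S i] by blast
  have "f_op n i (S \<star> T) = Some (switch r i (Suc i) (S \<star> T))"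
    by (rule f_op_Some[OF partition_le_add[OF lam mu] star_in_SSYT[OF lam mu S T] i(1) assms(1)[OF r]])
  then show ?thesis using star_switch[of i S r, OF lowers_in_row_mem[OF r]] S' by simp
qed

lemma e_op_star:
  assumes "\<And>r. raises_in_row i S r \<Longrightarrow> raises_in_row i (S \<star> T) r" and "e_op n i S = Some S'"
  shows "e_op n i (S \<star> T) = Some (S' \<star> T)"
proof -
  obtain r where r: "raises_in_row i S r" and S': "S' = switch r (Suc i) i S"
    using assms(2) e_op_iff[OF lam S i] by blast
  have "e_op n i (S \<star> T) = Some (switch r (Suc i) i (S \<star> T))"
    by (rule e_op_Some[OF partition_le_add[OF lam mu] star_in_SSYT[OF lam mu S T] i(1) assms(1)[OF r]])
  then show ?thesis using star_switch[of "Suc i" S r, OF raises_in_row_mem[OF r]] S' by simp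
qed

lemma f_op_star_exact:
  assumes "\<And>r. lowers_in_row i (S \<star> T) r \<longleftrightarrow> lowers_in_row i S r"
  shows "f_op n i (S \<star> T) = map_option (\<lambda>S. S \<star> T) (f_op n i S)"
proof (cases "f_op n i S")
  case None
  then have "\<not> lowers_in_row i S r" for r using f_op_Some[OF lam S i(1)] by fastforce
  then have "f_op n i (S \<star> T) = None"
    using assms by (intro f_op_None[OF partition_le_add[OF lam mu] star_in_SSYT[OF lam mu S T] i(1)]) blast
  then show ?thesis using None by simp
qed (use assms f_op_star in auto)

lemma e_op_star_exact:
  assumes "\<And>r. raises_in_row i (S \<star> T) r \<longleftrightarrow> raises_in_row i S r"
  shows "e_op n i (S \<star> T) = map_option (\<lambda>S. S \<star> T) (e_op n i S)"
proof (cases "e_op n i S")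
  case None
  then have "\<not> raises_in_row i S r" for r using e_op_Some[OF lam S i(1)] by fastforce
  then have "e_op n i (S \<star> T) = None"
    using assms by (intro e_op_None[OF partition_le_add[OF lam mu] star_in_SSYT[OF lam mu S T] i(1)]) blast
  then show ?thesis using None by simp
qed (use assms e_op_star in auto)

end

section \<open>Words of operators and coloured graphs\<close>

lemma word_act_Nil [simp]: "word_act op [] b = Some b"
  by (simp add: word_act_def)

lemma word_act_Cons [simp]: "word_act op (i # ws) b = Option.bind (word_act op ws b) (op i)"
  by (simp add: word_act_def)

text \<open>The common form of \<^const>\<open>E_set\<close> and \<^const>\<open>F_set\<close>.\<close>

definition word_orbit :: "(nat \<Rightarrow> 'b \<Rightarrow> 'b option) \<Rightarrow> nat set \<Rightarrow> 'b \<Rightarrow> 'b set" where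
  "word_orbit op I b = {b'. \<exists>ws\<in>lists I. word_act op ws b = Some b'}"

lemma E_set_orbit: "E_set B b = word_orbit (raising B) (colours B) b"
  and F_set_orbit: "F_set B b = word_orbit (lowering B) (colours B) b"
  by (simp_all add: E_set_def F_set_def word_orbit_def)

lemma orbit_refl: "b \<in> word_orbit op I b"
  unfolding word_orbit_def using word_act_Nil[of op b] by blast

lemma orbit_step:
  assumes "x \<in> word_orbit op I b" "i \<in> I" "op i x = Some y"
  shows "y \<in> word_orbit op I b"
proof -
  obtain ws where "ws \<in> lists I" "word_act op ws b = Some x"
    using assms(1) by (auto simp: word_orbit_def)
  then have "i # ws \<in> lists I" "word_act op (i # ws) b = Some y" using assms(2,3) by auto
  then show ?thesis unfolding word_orbit_def by blast
qed

lemma orbit_singleton_iff: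
  assumes "\<And>i. i \<in> I \<Longrightarrow> op i b \<noteq> Some b"
  shows "word_orbit op I b = {b} \<longleftrightarrow> (\<forall>i\<in>I. op i b = None)"
proof
  assume orbit: "word_orbit op I b = {b}"
  show "\<forall>i\<in>I. op i b = None"
  proof (rule ballI, rule ccontr)
    fix i assume i: "i \<in> I" "op i b \<noteq> None"
    then obtain y where y: "op i b = Some y" by blast
    have "y \<in> word_orbit op I b" by (rule orbit_step[where op = op, OF orbit_refl i(1) y])
    then show False using orbit assms[OF i(1)] y by simp
  qed
next
  assume none: "\<forall>i\<in>I. op i b = None"
  have "y = b" if "ws \<in> lists I" "word_act op ws b = Some y" for ws y
    using that
  proof (induction ws arbitrary: y)
    case (Cons i ws)
    then obtain x where x: "word_act op ws b = Some x" "op i x = Some y"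
      by (auto simp: bind_eq_Some_conv)
    then have "x = b" using Cons by auto
    moreover have "i \<in> I" using Cons.hyps by auto
    ultimately show ?case using none x(2) by auto
  qed simp
  then show "word_orbit op I b = {b}" using orbit_refl by (auto simp: word_orbit_def)
qed

text \<open>Apply \<open>op\<close> until it stops, which is at \<open>z\<close>, and return by \<open>op'\<close>.\<close>

lemma orbit_from_extremal:
  fixes m :: "'b \<Rightarrow> nat"
  assumes step: "\<And>x i y. x \<in> X \<Longrightarrow> i \<in> I \<Longrightarrow> op i x = Some y \<Longrightarrow> y \<in> X \<and> op' i y = Some x \<and> m y < m x"
    and extremal: "\<And>x. x \<in> X \<Longrightarrow> (\<forall>i\<in>I. op i x = None) \<Longrightarrow> x = z"
    and x: "x \<in> X"
  shows "x \<in> word_orbit op' I z"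
  using x
proof (induction "m x" arbitrary: x rule: less_induct)
  case less
  show ?case
  proof (cases "\<forall>i\<in>I. op i x = None")
    case True
    then show ?thesis using extremal less.prems orbit_refl by metis
  next
    case False
    then obtain i y where i: "i \<in> I" "op i x = Some y" by auto
    then have "y \<in> X" "op' i y = Some x" "m y < m x" using step less.prems by blast+
    then show ?thesis using less.hyps orbit_step i(1) by metis
  qed
qed

lemma extremal_unique:
  fixes m :: "'b \<Rightarrow> nat"
  assumes step: "\<And>x i y. x \<in> X \<Longrightarrow> i \<in> I \<Longrightarrow> op i x = Some y \<Longrightarrow> y \<in> X \<and> m y < m x"
    and unique: "\<And>x y. x \<in> X \<Longrightarrow> y \<in> X \<Longrightarrow> (\<forall>i\<in>I. op i x = None) \<Longrightarrow> (\<forall>i\<in>I. op i y = None) \<Longrightarrow> x = y"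
    and nonempty: "X \<noteq> {}"
  shows "\<exists>!b. b \<in> X \<and> word_orbit op I b = {b}"
proof -
  have iff: "word_orbit op I b = {b} \<longleftrightarrow> (\<forall>i\<in>I. op i b = None)" if "b \<in> X" for b
    using step[OF that] by (intro orbit_singleton_iff) blast
  obtain x where "x \<in> X" "\<And>y. y \<in> X \<Longrightarrow> m x \<le> m y"
    using ex_has_least_nat[of "\<lambda>x. x \<in> X" _ m] nonempty by blast
  then have "\<forall>i\<in>I. op i x = None"
    using step by (metis leD not_None_eq)
  then show ?thesis
    using \<open>x \<in> X\<close> iff unique by (intro ex1I[of _ x]) (simp, metis)
qed

lemma orbit_image:
  assumes exact: "\<And>x i. x \<in> X \<Longrightarrow> i \<in> I \<Longrightarrow> op' i (\<phi> x) = map_option \<phi> (op i x)"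
    and closed: "\<And>x i y. x \<in> X \<Longrightarrow> i \<in> I \<Longrightarrow> op i x = Some y \<Longrightarrow> y \<in> X"
    and z: "z \<in> X"
  shows "word_orbit op' I (\<phi> z) = \<phi> ` word_orbit op I z"
proof -
  have "word_act op' ws (\<phi> z) = map_option \<phi> (word_act op ws z)
      \<and> (\<forall>x. word_act op ws z = Some x \<longrightarrow> x \<in> X)" if "ws \<in> lists I" for ws
    using that
  proof (induction ws)
    case (Cons i ws)
    show ?case
    proof (cases "word_act op ws z")
      case (Some x)
      then show ?thesis using Cons exact closed by (auto simp: bind_eq_Some_conv)
    qed (use Cons in auto)
  qed (use z in simp)
  then show ?thesis by (auto simp: word_orbit_def image_iff)
qed

lemma orbit_subset:
  assumes "\<And>x i y. x \<in> X \<Longrightarrow> i \<in> I \<Longrightarrow> op i x = Some y \<Longrightarrow> y \<in> X" "z \<in> X"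
  shows "word_orbit op I z \<subseteq> X"
proof -
  have "x \<in> X" if "ws \<in> lists I" "word_act op ws z = Some x" for ws x
    using that by (induction ws arbitrary: x) (use assms in \<open>auto simp: bind_eq_Some_conv\<close>)
  then show ?thesis by (auto simp: word_orbit_def)
qed

lemma coloured_graph_isoI:
  assumes "wf_digraph G" "inj_on \<phi> (verts G)"
    and "\<And>x i y. (x, i, y) \<in> arcs G \<Longrightarrow> tail G (x, i, y) = x \<and> head G (x, i, y) = y"
    and "verts H = \<phi> ` verts G" "arcs H = (\<lambda>(x, i, y). (\<phi> x, i, \<phi> y)) ` arcs G"
    and "tail H = (\<lambda>(x, i, y). x)" "head H = (\<lambda>(x, i, y). y)"
  shows "coloured_graph_iso \<phi> G H"
proof -
  interpret wf_digraph G by fact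
  have vert: "x \<in> verts G \<and> y \<in> verts G" if "(x, i, y) \<in> arcs G" for x i y
    using that assms(3) wellformed by metis
  have "inj_on (\<lambda>(x, i, y). (\<phi> x, i, \<phi> y)) (arcs G)"
    using assms(2) vert by (auto intro!: inj_onI dest: inj_onD)
  then have "digraph_isomorphism (coloured_hom \<phi>)"
    unfolding digraph_isomorphism_def coloured_hom_def
    using assms(2,3) wf_digraph_axioms by auto
  moreover have "app_iso (coloured_hom \<phi>) G = H"
    using assms(4-7) by (intro pre_digraph.equality) (simp_all add: app_iso_def coloured_hom_def)
  ultimately show ?thesis by (simp add: coloured_graph_iso_def)
qed

lemma wf_crystal_graph: "wf_digraph (crystal_graph B)"
  by unfold_locales (auto simp: crystal_graph_def)

lemma coloured_graph_iso_onto_subgraph: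
  assumes colours: "colours B = colours D"
    and inj: "inj_on \<phi> (elts B)" and image: "\<phi> ` elts B \<subseteq> elts D"
    and arcs: "\<And>x i y. x \<in> elts B \<Longrightarrow> i \<in> colours B \<Longrightarrow> y \<in> elts B \<Longrightarrow>
      lowering D i (\<phi> x) = Some (\<phi> y) \<longleftrightarrow> lowering B i x = Some y"
  shows "coloured_graph_iso \<phi> (crystal_graph B) (crystal_graph D \<restriction> (\<phi> ` elts B))"
proof (rule coloured_graph_isoI[OF wf_crystal_graph])
  show "arcs (crystal_graph D \<restriction> (\<phi> ` elts B))
      = (\<lambda>(x, i, y). (\<phi> x, i, \<phi> y)) ` arcs (crystal_graph B)" (is "?L = ?R")
  proof
    show "?L \<subseteq> ?R"
    proof
      fix a assume "a \<in> ?L"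
      then obtain x i y where a: "a = (\<phi> x, i, \<phi> y)" and "x \<in> elts B" "y \<in> elts B"
        "i \<in> colours B" "lowering D i (\<phi> x) = Some (\<phi> y)"
        by (cases a) (auto simp: crystal_graph_def induce_subgraph_def colours)
      then have "(x, i, y) \<in> arcs (crystal_graph B)" using arcs by (simp add: crystal_graph_def)
      then show "a \<in> ?R" unfolding a by (rule rev_image_eqI) simp
    qed
    show "?R \<subseteq> ?L"
    proof
      fix a assume "a \<in> ?R"
      then obtain x i y where a: "a = (\<phi> x, i, \<phi> y)" and xy: "x \<in> elts B" "y \<in> elts B"
        "i \<in> colours B" and "lowering B i x = Some y"
        by (auto simp: crystal_graph_def)
      then have "lowering D i (\<phi> x) = Some (\<phi> y)" using arcs by blast
      then show "a \<in> ?L"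
        using xy image unfolding a by (simp add: crystal_graph_def induce_subgraph_def colours image_subset_iff)
    qed
  qed
qed (use inj in \<open>auto simp: crystal_graph_def induce_subgraph_def\<close>)

text \<open>Two images of the same coloured graph are isomorphic to each other, by way of that graph.\<close>

lemma coloured_graph_iso_transfer:
  assumes wf: "wf_digraph G" and G: "tail G = (\<lambda>(x, i, y). x)" "head G = (\<lambda>(x, i, y). y)"
    and \<phi>: "coloured_graph_iso \<phi> G H" and \<psi>: "coloured_graph_iso \<psi> G K"
  shows "coloured_graph_iso (\<psi> \<circ> inv_into (verts G) \<phi>) H K"
proof -
  let ?\<theta> = "\<psi> \<circ> inv_into (verts G) \<phi>"
  interpret G: wf_digraph G by fact
  have H: "H = app_iso (coloured_hom \<phi>) G" and K: "K = app_iso (coloured_hom \<psi>) G"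
    using \<phi> \<psi> by (simp_all add: coloured_graph_iso_def)
  have inj: "inj_on \<phi> (verts G)" "inj_on \<psi> (verts G)"
    using \<phi> \<psi> by (simp_all add: coloured_graph_iso_def G.digraph_isomorphism_def coloured_hom_def)
  have vert: "x \<in> verts G \<and> y \<in> verts G" if "(x, i, y) \<in> arcs G" for x i y
    using G.wellformed[OF that] by (simp add: G)
  have \<theta>: "?\<theta> (\<phi> x) = \<psi> x" if "x \<in> verts G" for x using that inj(1) by simp
  show ?thesis
  proof (rule coloured_graph_isoI)
    show "wf_digraph H"
      using \<phi> unfolding coloured_graph_iso_def by (metis G.wf_digraphI_app_iso)
    show "inj_on ?\<theta> (verts H)"
      unfolding H using \<theta> inj(2) by (auto simp: coloured_hom_def inj_on_def)
    show "verts K = ?\<theta> ` verts H"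
      unfolding H K using \<theta> by (force simp: coloured_hom_def image_iff)
    show "arcs K = (\<lambda>(x, i, y). (?\<theta> x, i, ?\<theta> y)) ` arcs H"
    proof -
      have "(\<lambda>(x, i, y). (?\<theta> x, i, ?\<theta> y)) ` (\<lambda>(x, i, y). (\<phi> x, i, \<phi> y)) ` arcs G
          = (\<lambda>(x, i, y). (\<psi> x, i, \<psi> y)) ` arcs G"
        unfolding image_image by (rule image_cong[OF refl]) (use \<theta> vert in \<open>auto simp del: o_apply\<close>)
      then show ?thesis by (simp add: H K coloured_hom_def)
    qed
  qed (simp_all add: H K coloured_hom_def)
qed

section \<open>The embeddings\<close>

context
  fixes n :: nat and lam :: "nat \<Rightarrow> nat"
  assumes lam: "partition_le n lam"
begin

lemma f_op_step_conj:
  assumes "x \<in> SSYT n lam" "i \<in> {1..<n}" "f_op n i x = Some y"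
  shows "y \<in> SSYT n lam \<and> e_op n i y = Some x \<and>
    entry_weight (\<lambda>x. n - x) n y < entry_weight (\<lambda>x. n - x) n x"
  using f_op_step[OF lam assms(1) _ _ assms(3)] assms(2) by simp

lemma e_op_step_conj:
  assumes "x \<in> SSYT n lam" "i \<in> {1..<n}" "e_op n i x = Some y"
  shows "y \<in> SSYT n lam \<and> f_op n i y = Some x \<and> entry_weight id n y < entry_weight id n x"
  using e_op_step[OF lam assms(1) _ _ assms(3)] assms(2) by simp

lemma highest_weight_vector_row_constant:
  "highest_weight_vector (tableau_crystal n lam) = row_constant lam"
proof -
  have "\<exists>!b. b \<in> SSYT n lam \<and> word_orbit (e_op n) {1..<n} b = {b}"
  proof (rule extremal_unique[where m = "entry_weight id n"])
    show "y \<in> SSYT n lam \<and> entry_weight id n y < entry_weight id n x"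
      if "x \<in> SSYT n lam" "i \<in> {1..<n}" "e_op n i x = Some y" for x i y
      using e_op_step_conj[OF that] by simp
    show "x = y" if "x \<in> SSYT n lam" "y \<in> SSYT n lam"
      "\<forall>i\<in>{1..<n}. e_op n i x = None" "\<forall>i\<in>{1..<n}. e_op n i y = None" for x y
      using unraisable_row_constant[OF lam that(1)] unraisable_row_constant[OF lam that(2)] that(3,4)
      by simp
    show "SSYT n lam \<noteq> {}" using row_constant_in_SSYT[OF lam] by blast
  qed
  then have unique: "\<exists>!b. b \<in> elts (tableau_crystal n lam) \<and> E_set (tableau_crystal n lam) b = {b}"
    by (simp add: E_set_orbit tableau_crystal_def)
  let ?b = "highest_weight_vector (tableau_crystal n lam)"
  have "?b \<in> SSYT n lam" "word_orbit (e_op n) {1..<n} ?b = {?b}"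
    using theI'[OF unique]
    by (simp_all add: highest_weight_vector_def E_set_orbit tableau_crystal_def)
  moreover have "e_op n i ?b \<noteq> Some ?b" if "i \<in> {1..<n}" for i
    using e_op_step(3)[OF lam \<open>?b \<in> SSYT n lam\<close>] that by fastforce
  ultimately show ?thesis
    using unraisable_row_constant[OF lam] orbit_singleton_iff[of "{1..<n}" "e_op n" ?b] by simp
qed

text \<open>Existence holds because repeated lowering stops, and uniqueness because the row contents are
  determined. The row contents serve as the description of the lowest weight vector in what follows.\<close>

lemma lowest_weight_vector_props:
  defines "Z \<equiv> lowest_weight_vector (tableau_crystal n lam)"
  shows "Z \<in> SSYT n lam"
    and "\<And>T. T \<in> SSYT n lam \<Longrightarrow> (\<forall>i\<in>{1..<n}. f_op n i T = None) \<Longrightarrow> T = Z"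
    and "\<And>v r. v \<le> n \<Longrightarrow> num_le Z v r = lam (n + r - v)"
proof -
  have eq: "x = y" if "x \<in> SSYT n lam" "y \<in> SSYT n lam"
    "\<forall>i\<in>{1..<n}. f_op n i x = None" "\<forall>i\<in>{1..<n}. f_op n i y = None" for x y
    using unlowerable_num_le[OF lam] that by (intro tableau_eqI[OF that(1,2)]) simp
  have "\<exists>!b. b \<in> SSYT n lam \<and> word_orbit (f_op n) {1..<n} b = {b}"
  proof (rule extremal_unique[where m = "entry_weight (\<lambda>x. n - x) n"])
    show "y \<in> SSYT n lam \<and> entry_weight (\<lambda>x. n - x) n y < entry_weight (\<lambda>x. n - x) n x"
      if "x \<in> SSYT n lam" "i \<in> {1..<n}" "f_op n i x = Some y" for x i y
      using f_op_step_conj[OF that] by simp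
    show "SSYT n lam \<noteq> {}" using row_constant_in_SSYT[OF lam] by blast
  qed (rule eq)
  then have unique: "\<exists>!b. b \<in> elts (tableau_crystal n lam) \<and> F_set (tableau_crystal n lam) b = {b}"
    by (simp add: F_set_orbit tableau_crystal_def)
  have Z: "Z \<in> SSYT n lam" "word_orbit (f_op n) {1..<n} Z = {Z}"
    using theI'[OF unique]
    by (simp_all add: Z_def lowest_weight_vector_def F_set_orbit tableau_crystal_def)
  moreover have "f_op n i Z \<noteq> Some Z" if "i \<in> {1..<n}" for i
    using f_op_step(3)[OF lam Z(1)] that by fastforce
  ultimately have none: "\<forall>i\<in>{1..<n}. f_op n i Z = None"
    using orbit_singleton_iff[of "{1..<n}" "f_op n" Z] by simp
  show "Z \<in> SSYT n lam" by (rule Z)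
  show "T = Z" if "T \<in> SSYT n lam" "\<forall>i\<in>{1..<n}. f_op n i T = None" for T
    using eq that Z(1) none by blast
  show "num_le Z v r = lam (n + r - v)" if "v \<le> n" for v r
    using unlowerable_num_le[OF lam Z(1) _ that] none by simp
qed

lemma SSYT_eq_orbit_lowest:
  "SSYT n lam = word_orbit (e_op n) {1..<n} (lowest_weight_vector (tableau_crystal n lam))"
proof
  show "SSYT n lam \<subseteq> word_orbit (e_op n) {1..<n} (lowest_weight_vector (tableau_crystal n lam))"
  proof
    fix T assume "T \<in> SSYT n lam"
    with f_op_step_conj lowest_weight_vector_props(2)
    show "T \<in> word_orbit (e_op n) {1..<n} (lowest_weight_vector (tableau_crystal n lam))"
      by (rule orbit_from_extremal)
  qed
  show "word_orbit (e_op n) {1..<n} (lowest_weight_vector (tableau_crystal n lam)) \<subseteq> SSYT n lam"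
    using e_op_step(1)[OF lam] by (intro orbit_subset lowest_weight_vector_props(1)) auto
qed

lemma SSYT_eq_orbit_highest:
  "SSYT n lam = word_orbit (f_op n) {1..<n} (highest_weight_vector (tableau_crystal n lam))"
  unfolding highest_weight_vector_row_constant
proof
  show "SSYT n lam \<subseteq> word_orbit (f_op n) {1..<n} (row_constant lam)"
  proof
    fix T assume T: "T \<in> SSYT n lam"
    have "x = row_constant lam" if "x \<in> SSYT n lam" "\<forall>i\<in>{1..<n}. e_op n i x = None" for x
      using unraisable_row_constant[OF lam that(1)] that(2) by simp
    with e_op_step_conj show "T \<in> word_orbit (f_op n) {1..<n} (row_constant lam)"
      using T by (rule orbit_from_extremal)
  qed
  show "word_orbit (f_op n) {1..<n} (row_constant lam) \<subseteq> SSYT n lam"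
    using f_op_step(1)[OF lam] by (intro orbit_subset row_constant_in_SSYT[OF lam]) auto
qed

end

context
  fixes n :: nat and lam mu :: "nat \<Rightarrow> nat" and T :: tableau
  assumes lam: "partition_le n lam" and mu: "partition_le n mu" and T: "T \<in> SSYT n mu"
begin

lemma crystal_embedding_star:
  assumes f: "\<And>S i r. S \<in> SSYT n lam \<Longrightarrow> 1 \<le> i \<Longrightarrow> i < n \<Longrightarrow> lowers_in_row i S r
      \<Longrightarrow> lowers_in_row i (S \<star> T) r"
    and e: "\<And>S i r. S \<in> SSYT n lam \<Longrightarrow> 1 \<le> i \<Longrightarrow> i < n \<Longrightarrow> raises_in_row i S r
      \<Longrightarrow> raises_in_row i (S \<star> T) r"
  shows "crystal_embedding (tableau_crystal n lam) (tableau_crystal n (\<lambda>r. lam r + mu r)) (\<lambda>S. S \<star> T)"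
proof -
  have "f_op n i (S \<star> T) = Some (S' \<star> T)"
    if "S \<in> SSYT n lam" "1 \<le> i" "i < n" "f_op n i S = Some S'" for S i S'
    using f_op_star[OF lam mu that(1) T that(2,3) f[OF that(1-3)] that(4)] by simp
  moreover have "e_op n i (S \<star> T) = Some (S' \<star> T)"
    if "S \<in> SSYT n lam" "1 \<le> i" "i < n" "e_op n i S = Some S'" for S i S'
    using e_op_star[OF lam mu that(1) T that(2,3) e[OF that(1-3)] that(4)] by simp
  ultimately show ?thesis
    unfolding crystal_embedding_def tableau_crystal_def
    using star_in_SSYT[OF lam mu _ T] inj_star by auto
qed

lemma graph_iso_star:
  assumes arcs: "\<And>S S' i. S \<in> SSYT n lam \<Longrightarrow> S' \<in> SSYT n lam \<Longrightarrow> 1 \<le> i \<Longrightarrow> i < n \<Longrightarrow>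
      f_op n i (S \<star> T) = Some (S' \<star> T) \<longleftrightarrow> f_op n i S = Some S'"
  shows "coloured_graph_iso (\<lambda>S. S \<star> T) (crystal_graph (tableau_crystal n lam))
    (crystal_graph (tableau_crystal n (\<lambda>r. lam r + mu r)) \<restriction> ((\<lambda>S. S \<star> T) ` SSYT n lam))"
proof -
  let ?B = "tableau_crystal n lam" and ?D = "tableau_crystal n (\<lambda>r. lam r + mu r)"
  have "coloured_graph_iso (\<lambda>S. S \<star> T) (crystal_graph ?B)
      (crystal_graph ?D \<restriction> ((\<lambda>S. S \<star> T) ` elts ?B))"
  proof (rule coloured_graph_iso_onto_subgraph)
    show "inj_on (\<lambda>S. S \<star> T) (elts ?B)" by (simp add: tableau_crystal_def inj_star)
    show "(\<lambda>S. S \<star> T) ` elts ?B \<subseteq> elts ?D"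
      using star_in_SSYT[OF lam mu _ T] by (auto simp: tableau_crystal_def)
  qed (use arcs in \<open>simp_all add: tableau_crystal_def\<close>)
  then show ?thesis by (simp add: tableau_crystal_def)
qed

end

theorem theorem6p6:
  fixes n :: nat and lam mu :: "nat \<Rightarrow> nat"
  defines "B \<equiv> tableau_crystal n lam"
    and "C \<equiv> tableau_crystal n mu"
    and "D \<equiv> tableau_crystal n (\<lambda>r. lam r + mu r)"
  defines "A_lam \<equiv> highest_weight_vector B" and "Z_lam \<equiv> lowest_weight_vector B"
    and "A_mu \<equiv> highest_weight_vector C" and "Z_mu \<equiv> lowest_weight_vector C"
  assumes "partition_le n lam" and "partition_le n mu"
  shows "(\<forall>T. T = A_mu \<or> T = Z_mu \<longrightarrow> crystal_embedding B D (\<lambda>T'. T' \<star> T)) \<and>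
    (\<lambda>T'. T' \<star> A_mu) ` elts B = E_set D (Z_lam \<star> A_mu) \<and>
    (\<lambda>T'. T' \<star> Z_mu) ` elts B = F_set D (A_lam \<star> Z_mu) \<and>
    coloured_graph_iso (\<lambda>T'. T' \<star> A_mu)
      (crystal_graph B) (crystal_graph D \<restriction> E_set D (Z_lam \<star> A_mu)) \<and>
    coloured_graph_iso (\<lambda>T'. T' \<star> Z_mu)
      (crystal_graph B) (crystal_graph D \<restriction> F_set D (A_lam \<star> Z_mu)) \<and>
    (\<exists>\<theta>. coloured_graph_iso \<theta>
        (crystal_graph D \<restriction> E_set D (Z_lam \<star> A_mu))
        (crystal_graph D \<restriction> F_set D (A_lam \<star> Z_mu)) \<and>
      (\<forall>T'\<in>elts B. \<theta> (T' \<star> A_mu) = T' \<star> Z_mu))"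
proof -
  note lam = \<open>partition_le n lam\<close> and mu = \<open>partition_le n mu\<close>
  have A_mu: "A_mu = row_constant mu"
    unfolding A_mu_def C_def by (rule highest_weight_vector_row_constant[OF mu])
  then have A_mu_in: "A_mu \<in> SSYT n mu" using row_constant_in_SSYT[OF mu] by simp
  have Z_mu_in: "Z_mu \<in> SSYT n mu" and Z_mu: "\<And>v r. v \<le> n \<Longrightarrow> num_le Z_mu v r = mu (n + r - v)"
    unfolding Z_mu_def C_def using lowest_weight_vector_props[OF mu] by blast+
  have Z_lam_in: "Z_lam \<in> SSYT n lam"
    unfolding Z_lam_def B_def by (rule lowest_weight_vector_props(1)[OF lam])
  have A_lam_in: "A_lam \<in> SSYT n lam"
    unfolding A_lam_def B_def highest_weight_vector_row_constant[OF lam]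
    by (rule row_constant_in_SSYT[OF lam])
  have elts: "elts B = SSYT n lam" by (simp add: B_def tableau_crystal_def)

  have e_exact: "e_op n i (S \<star> A_mu) = map_option (\<lambda>S. S \<star> A_mu) (e_op n i S)"
    if "S \<in> SSYT n lam" "1 \<le> i" "i < n" for S i
    unfolding A_mu
    by (rule e_op_star_exact[OF lam mu that(1) A_mu_in[unfolded A_mu] that(2,3)
          raises_star_row_constant_iff[OF lam that(1,2) mu]])
  have f_exact: "f_op n i (S \<star> Z_mu) = map_option (\<lambda>S. S \<star> Z_mu) (f_op n i S)"
    if "S \<in> SSYT n lam" "1 \<le> i" "i < n" for S i
    by (rule f_op_star_exact[OF lam mu that(1) Z_mu_in that(2,3)
          lowers_star_lowest_iff[OF Z_mu that(2,3)]])

  have emb_A: "crystal_embedding B D (\<lambda>T'. T' \<star> A_mu)"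
    unfolding B_def D_def
    using lowers_star_row_constant[OF lam _ _ mu] raises_star_row_constant_iff[OF lam _ _ mu]
    by (intro crystal_embedding_star[OF lam mu A_mu_in]) (simp_all add: A_mu)
  have emb_Z: "crystal_embedding B D (\<lambda>T'. T' \<star> Z_mu)"
    unfolding B_def D_def
    using lowers_star_lowest_iff[OF Z_mu] raises_star_lowest[OF Z_mu]
    by (intro crystal_embedding_star[OF lam mu Z_mu_in]) simp_all

  have image_A: "(\<lambda>T'. T' \<star> A_mu) ` elts B = E_set D (Z_lam \<star> A_mu)"
  proof -
    have "word_orbit (e_op n) {1..<n} (Z_lam \<star> A_mu)
        = (\<lambda>S. S \<star> A_mu) ` word_orbit (e_op n) {1..<n} Z_lam"
      using e_exact e_op_step(1)[OF lam] Z_lam_in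
      by (intro orbit_image[where X = "SSYT n lam" and \<phi> = "\<lambda>S. S \<star> A_mu"]) auto
    also have "word_orbit (e_op n) {1..<n} Z_lam = SSYT n lam"
      unfolding Z_lam_def B_def by (rule SSYT_eq_orbit_lowest[OF lam, symmetric])
    finally show ?thesis by (simp add: elts E_set_orbit D_def tableau_crystal_def)
  qed
  have image_Z: "(\<lambda>T'. T' \<star> Z_mu) ` elts B = F_set D (A_lam \<star> Z_mu)"
  proof -
    have "word_orbit (f_op n) {1..<n} (A_lam \<star> Z_mu)
        = (\<lambda>S. S \<star> Z_mu) ` word_orbit (f_op n) {1..<n} A_lam"
      using f_exact f_op_step(1)[OF lam] A_lam_in
      by (intro orbit_image[where X = "SSYT n lam" and \<phi> = "\<lambda>S. S \<star> Z_mu"]) auto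
    also have "word_orbit (f_op n) {1..<n} A_lam = SSYT n lam"
      unfolding A_lam_def B_def by (rule SSYT_eq_orbit_highest[OF lam, symmetric])
    finally show ?thesis by (simp add: elts F_set_orbit D_def tableau_crystal_def)
  qed

  have iso_A: "coloured_graph_iso (\<lambda>T'. T' \<star> A_mu)
      (crystal_graph B) (crystal_graph D \<restriction> E_set D (Z_lam \<star> A_mu))"
    unfolding image_A[symmetric] elts unfolding B_def D_def
  proof (rule graph_iso_star[OF lam mu A_mu_in])
    fix S S' i
    assume S: "S \<in> SSYT n lam" "S' \<in> SSYT n lam" and i: "1 \<le> i" "i < n"
    show "f_op n i (S \<star> A_mu) = Some (S' \<star> A_mu) \<longleftrightarrow> f_op n i S = Some S'"
    proof
      assume "f_op n i S = Some S'"
      then show "f_op n i (S \<star> A_mu) = Some (S' \<star> A_mu)"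
        using f_op_star[OF lam mu S(1) A_mu_in i] lowers_star_row_constant[OF lam S(1) i(1) mu]
        unfolding A_mu by blast
    next
      \<comment> \<open>Only the raising operators commute with the embedding without exception, so the arc is
        pulled back in the opposite direction.\<close>
      assume "f_op n i (S \<star> A_mu) = Some (S' \<star> A_mu)"
      then have "e_op n i (S' \<star> A_mu) = Some (S \<star> A_mu)"
        using f_op_step(2)[OF partition_le_add[OF lam mu] star_in_SSYT[OF lam mu S(1) A_mu_in] i] by blast
      then obtain S'' where "e_op n i S' = Some S''" "S'' \<star> A_mu = S \<star> A_mu"
        using e_exact[OF S(2) i] by auto
      moreover from this have "S'' = S"
        using inj_star[of A_mu n lam] S(1) e_op_step(1)[OF lam S(2) i] by (auto dest: inj_onD)
      ultimately show "f_op n i S = Some S'" using e_op_step(2)[OF lam S(2) i] by blast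
    qed
  qed
  have iso_Z: "coloured_graph_iso (\<lambda>T'. T' \<star> Z_mu)
      (crystal_graph B) (crystal_graph D \<restriction> F_set D (A_lam \<star> Z_mu))"
    unfolding image_Z[symmetric] elts unfolding B_def D_def
  proof (rule graph_iso_star[OF lam mu Z_mu_in])
    fix S S' i
    assume S: "S \<in> SSYT n lam" "S' \<in> SSYT n lam" and i: "1 \<le> i" "i < n"
    show "f_op n i (S \<star> Z_mu) = Some (S' \<star> Z_mu) \<longleftrightarrow> f_op n i S = Some S'"
      using f_exact[OF S(1) i] inj_star[of Z_mu n lam] S(2) f_op_step(1)[OF lam S(1) i]
      by (auto dest: inj_onD)
  qed

  let ?\<theta> = "(\<lambda>T'. T' \<star> Z_mu) \<circ> inv_into (elts B) (\<lambda>T'. T' \<star> A_mu)"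
  have "coloured_graph_iso ?\<theta> (crystal_graph D \<restriction> E_set D (Z_lam \<star> A_mu))
      (crystal_graph D \<restriction> F_set D (A_lam \<star> Z_mu))"
    using coloured_graph_iso_transfer[OF wf_crystal_graph _ _ iso_A iso_Z]
    by (simp add: crystal_graph_def)
  moreover have "\<forall>T'\<in>elts B. ?\<theta> (T' \<star> A_mu) = T' \<star> Z_mu"
    using inv_into_f_f[OF inj_star[of A_mu n lam]] unfolding elts o_apply by simp
  ultimately show ?thesis
    using emb_A emb_Z image_A image_Z iso_A iso_Z by blast
qed

end
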